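(* Every asymptotic cone of Thompson's group $F$ is infinite-dimensional.
   Context: Thompson's group $F$ is the group with presentation $\langle x_k,\ k\ge 0 \mid x_i^{-1}x_jx_i=x_{j+1}\text{ if } i<j\rangle$. It is generated by $x_0$ and $x_1$, and is given the word metric $d$ with respect to $\{x_0,x_1\}$. For a non-principal ultrafilter $\omega$ on $\mathbb{N}$ and a sequence of positive real scaling factors $(\lambda_m)$ with $\lambda_m\to\infty$, the asymptotic cone of $F$ is the ultralimit along $\omega$ of the pointed metric spaces $(F,\,d/\lambda_m,\,1)$ based at the identity element: its points are the classes of sequences $(g_m)$ in $F$ with $d(1,g_m)/\lambda_m$ bounded, two sequences being identified when $\lim_\omega d(g_m,h_m)/\lambda_m=0$, with metric $\lim_\omega d(g_m,h_m)/\lambda_m$. Infinite-dimensional means of infinite topological (covering) dimension. *)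

theory Defs
  imports "HOL-Analysis.Analysis" "HOL-Algebra.Generated_Groups"
begin

section \<open>Groups given by presentations\<close>

text \<open>
  A word is a list of signed generators: \<open>(a, True)\<close> stands for the generator \<open>a\<close> and
  \<open>(a, False)\<close> for its formal inverse.  The set \<open>R\<close> of relations consists of pairs \<open>(u, v)\<close>, read as \<open>u = v\<close>.
\<close>

type_synonym 'g word = "('g \<times> bool) list"

inductive word_eq :: "('g word \<times> 'g word) set \<Rightarrow> 'g word \<Rightarrow> 'g word \<Rightarrow> bool"
  for R where
  rel: "(u, v) \<in> R \<Longrightarrow> word_eq R u v"
| cancel: "word_eq R [(a, e), (a, \<not> e)] []"
| append: "word_eq R u u' \<Longrightarrow> word_eq R v v' \<Longrightarrow> word_eq R (u @ v) (u' @ v')"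
| refl: "word_eq R u u"
| sym: "word_eq R u v \<Longrightarrow> word_eq R v u"
| trans: "word_eq R u v \<Longrightarrow> word_eq R v w \<Longrightarrow> word_eq R u w"

definition word_class :: "('g word \<times> 'g word) set \<Rightarrow> 'g word \<Rightarrow> 'g word set" where
  "word_class R u = {v. word_eq R u v}"

definition presented_group :: "('g word \<times> 'g word) set \<Rightarrow> 'g word set monoid" where
  "presented_group R =
    \<lparr>carrier = range (word_class R),
     mult = (\<lambda>A B. \<Union>u\<in>A. \<Union>v\<in>B. word_class R (u @ v)),
     one = word_class R []\<rparr>"

lemma word_class_eq_iff: "word_class R u = word_class R v \<longleftrightarrow> word_eq R u v"
proof
  assume "word_class R u = word_class R v"
  then have "v \<in> word_class R u"
    by (simp add: word_class_def word_eq.refl)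
  then show "word_eq R u v"
    by (simp add: word_class_def)
next
  assume "word_eq R u v"
  then show "word_class R u = word_class R v"
    unfolding word_class_def by (blast intro: word_eq.sym word_eq.trans)
qed

lemma presented_group_mult:
  "word_class R u \<otimes>\<^bsub>presented_group R\<^esub> word_class R v = word_class R (u @ v)"
proof -
  have "word_class R (u' @ v') = word_class R (u @ v)"
    if "u' \<in> word_class R u" "v' \<in> word_class R v" for u' v'
  proof -
    have "word_eq R u u'" "word_eq R v v'"
      using that by (simp_all add: word_class_def)
    then show ?thesis
      unfolding word_class_eq_iff by (rule word_eq.sym[OF word_eq.append])
  qed
  then have "(\<Union>u'\<in>word_class R u. \<Union>v'\<in>word_class R v. word_class R (u' @ v'))
      = (\<Union>u'\<in>word_class R u. \<Union>v'\<in>word_class R v. word_class R (u @ v))"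
    by (intro SUP_cong HOL.refl) blast
  moreover have "u \<in> word_class R u" "v \<in> word_class R v"
    by (simp_all add: word_class_def word_eq.refl)
  then have "word_class R u \<noteq> {}" "word_class R v \<noteq> {}"
    by blast+
  ultimately show ?thesis
    by (simp add: presented_group_def)
qed

lemma presented_group_one: "\<one>\<^bsub>presented_group R\<^esub> = word_class R []"
  by (simp add: presented_group_def)

lemma presented_group_carrier: "carrier (presented_group R) = range (word_class R)"
  by (simp add: presented_group_def)

lemma word_inverse:
  "word_eq R (rev (map (\<lambda>(a, e). (a, \<not> e)) u) @ u) []"
proof (induction u)
  case Nil
  show ?case by (simp add: word_eq.refl)
next
  case (Cons x u)
  obtain a e where x: "x = (a, e)" by (cases x)
  let ?i = "rev (map (\<lambda>(a, e). (a, \<not> e)) u)"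
  have "word_eq R [(a, \<not> e), (a, e)] []"
    using word_eq.cancel[of R a "\<not> e"] by simp
  then have "word_eq R ([(a, \<not> e), (a, e)] @ u) ([] @ u)"
    using word_eq.refl by (rule word_eq.append)
  then have "word_eq R (?i @ ([(a, \<not> e), (a, e)] @ u)) (?i @ ([] @ u))"
    by (rule word_eq.append[OF word_eq.refl])
  then show ?case
    using Cons.IH word_eq.trans by (fastforce simp: x)
qed

lemma presented_group_is_group: "group (presented_group R)"
proof (rule groupI)
  fix x y z
  assume "x \<in> carrier (presented_group R)"
  then obtain u where u: "x = word_class R u"
    unfolding presented_group_carrier by (rule rangeE)
  show "\<one>\<^bsub>presented_group R\<^esub> \<otimes>\<^bsub>presented_group R\<^esub> x = x"
    unfolding u presented_group_mult presented_group_one append_Nil by (rule HOL.refl)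
  show "\<exists>y\<in>carrier (presented_group R). y \<otimes>\<^bsub>presented_group R\<^esub> x = \<one>\<^bsub>presented_group R\<^esub>"
    unfolding u presented_group_carrier presented_group_one bex_simps presented_group_mult
      word_class_eq_iff
    using word_inverse by (rule exI)
  assume "y \<in> carrier (presented_group R)"
  then obtain v where v: "y = word_class R v"
    unfolding presented_group_carrier by (rule rangeE)
  show "x \<otimes>\<^bsub>presented_group R\<^esub> y \<in> carrier (presented_group R)"
    unfolding u v presented_group_mult presented_group_carrier by (rule rangeI)
  assume "z \<in> carrier (presented_group R)"
  then obtain w where w: "z = word_class R w"
    unfolding presented_group_carrier by (rule rangeE)
  show "x \<otimes>\<^bsub>presented_group R\<^esub> y \<otimes>\<^bsub>presented_group R\<^esub> z = x \<otimes>\<^bsub>presented_group R\<^esub> (y \<otimes>\<^bsub>presented_group R\<^esub> z)"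
    unfolding u v w presented_group_mult append_assoc by (rule HOL.refl)
next
  show "\<one>\<^bsub>presented_group R\<^esub> \<in> carrier (presented_group R)"
    unfolding presented_group_one presented_group_carrier by (rule rangeI)
qed


section \<open>Thompson's group F\<close>

definition thompson_relations :: "(nat word \<times> nat word) set" where
  "thompson_relations =
    {([(i, False), (j, True), (i, True)], [(Suc j, True)]) | i j. i < j}"

definition thompson_F :: "nat word set monoid" where
  "thompson_F = presented_group thompson_relations"

definition thompson_gen :: "nat \<Rightarrow> nat word set" where
  "thompson_gen k = word_class thompson_relations [(k, True)]"

lemma group_thompson_F: "group thompson_F"
  by (simp add: thompson_F_def presented_group_is_group)

lemma thompson_gen_closed: "thompson_gen k \<in> carrier thompson_F"
  by (simp add: thompson_gen_def thompson_F_def presented_group_carrier)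

lemma inv_thompson_gen:
  "inv\<^bsub>thompson_F\<^esub> thompson_gen k = word_class thompson_relations [(k, False)]"
proof (rule group.inv_equality[OF group_thompson_F _ thompson_gen_closed])
  show "word_class thompson_relations [(k, False)] \<otimes>\<^bsub>thompson_F\<^esub> thompson_gen k = \<one>\<^bsub>thompson_F\<^esub>"
    using word_eq.cancel[of thompson_relations k False]
    by (simp add: thompson_F_def thompson_gen_def presented_group_mult presented_group_one
        word_class_eq_iff)
qed (simp add: thompson_F_def presented_group_carrier)

lemma thompson_relation:
  assumes "i < j"
  shows "inv\<^bsub>thompson_F\<^esub> thompson_gen i \<otimes>\<^bsub>thompson_F\<^esub> thompson_gen j \<otimes>\<^bsub>thompson_F\<^esub> thompson_gen i
    = thompson_gen (Suc j)"
proof -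
  have "word_eq thompson_relations [(i, False), (j, True), (i, True)] [(Suc j, True)]"
    using assms by (intro word_eq.rel) (auto simp: thompson_relations_def)
  then show ?thesis
    by (subst inv_thompson_gen)
      (simp add: thompson_F_def thompson_gen_def presented_group_mult word_class_eq_iff)
qed

lemma thompson_generated:
  "generate thompson_F {thompson_gen 0, thompson_gen 1} = carrier thompson_F"
proof
  interpret F: group thompson_F by (rule group_thompson_F)
  let ?H = "generate thompson_F {thompson_gen 0, thompson_gen 1}"
  show "?H \<subseteq> carrier thompson_F"
    by (rule F.generate_incl) (simp add: thompson_gen_closed)
  have gen: "thompson_gen (Suc k) \<in> ?H" for k
  proof (induction k)
    case 0
    show ?case by (auto intro: generate.incl)
  next
    case (Suc k)
    then show ?case
      using thompson_relation[of 0 "Suc k"]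
      by (metis generate.eng generate.incl generate.inv insertI1 zero_less_Suc)
  qed
  have gen: "thompson_gen k \<in> ?H" for k
  proof (cases k)
    case 0
    then show ?thesis by (simp add: generate.incl)
  next
    case (Suc j)
    then show ?thesis using gen[of j] by simp
  qed
  have sub: "subgroup ?H thompson_F"
    by (rule F.generate_is_subgroup) (simp add: thompson_gen_closed)
  have letter: "word_class thompson_relations [(a, e)] \<in> ?H" for a e
    using gen[of a] subgroup.m_inv_closed[OF sub gen[of a]] inv_thompson_gen[of a]
    by (cases e) (simp_all add: thompson_gen_def)
  have "word_class thompson_relations u \<in> ?H" for u
  proof (induction u)
    case Nil
    show ?case
      using generate.one[of thompson_F]
      by (simp add: thompson_F_def presented_group_one)
  next
    case (Cons x u)
    obtain a e where "x = (a, e)" by (cases x)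
    then show ?case
      using generate.eng[OF letter[of a e] Cons.IH]
      by (simp add: thompson_F_def presented_group_mult)
  qed
  then show "carrier thompson_F \<subseteq> ?H"
    by (auto simp: thompson_F_def presented_group_carrier)
qed


section \<open>Word metrics\<close>

definition word_length :: "('a, 'b) monoid_scheme \<Rightarrow> 'a set \<Rightarrow> 'a \<Rightarrow> nat" where
  "word_length G S g =
    (LEAST n. \<exists>ws. length ws = n \<and> set ws \<subseteq> S \<union> (\<lambda>s. inv\<^bsub>G\<^esub> s) ` S
      \<and> foldr (\<lambda>x y. x \<otimes>\<^bsub>G\<^esub> y) ws \<one>\<^bsub>G\<^esub> = g)"

text \<open>
  The locale \<^locale>\<open>Metric_space\<close> wants distances to be nonnegative and symmetric off the carrier too;
  hence the value 0 there, here and for ultralimits below.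
\<close>

definition word_dist :: "('a, 'b) monoid_scheme \<Rightarrow> 'a set \<Rightarrow> 'a \<Rightarrow> 'a \<Rightarrow> real" where
  "word_dist G S g h =
    (if g \<in> carrier G \<and> h \<in> carrier G then real (word_length G S (inv\<^bsub>G\<^esub> g \<otimes>\<^bsub>G\<^esub> h)) else 0)"

context group
begin

definition spells :: "'a set \<Rightarrow> 'a list \<Rightarrow> 'a \<Rightarrow> bool" where
  "spells S ws g \<longleftrightarrow> set ws \<subseteq> S \<union> (\<lambda>s. inv s) ` S \<and> foldr (\<otimes>) ws \<one> = g"

lemma word_length_spells: "word_length G S g = (LEAST n. \<exists>ws. length ws = n \<and> spells S ws g)"
  by (simp add: word_length_def spells_def)

lemma word_length_le: "spells S ws g \<Longrightarrow> word_length G S g \<le> length ws"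
  unfolding word_length_spells by (rule Least_le) blast

lemma foldr_closed: "set ws \<subseteq> carrier G \<Longrightarrow> foldr (\<otimes>) ws \<one> \<in> carrier G"
  by (induction ws) auto

lemma foldr_mult:
  "set ws \<subseteq> carrier G \<Longrightarrow> set vs \<subseteq> carrier G \<Longrightarrow>
    foldr (\<otimes>) (ws @ vs) \<one> = foldr (\<otimes>) ws \<one> \<otimes> foldr (\<otimes>) vs \<one>"
  by (induction ws) (auto simp: m_assoc foldr_closed simp del: foldr_append)

lemma foldr_inv:
  "set ws \<subseteq> carrier G \<Longrightarrow> foldr (\<otimes>) (rev (map (\<lambda>s. inv s) ws)) \<one> = inv (foldr (\<otimes>) ws \<one>)"
proof (induction ws)
  case (Cons x ws)
  have "foldr (\<otimes>) (rev (map (\<lambda>s. inv s) ws) @ [inv x]) \<one>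
      = foldr (\<otimes>) (rev (map (\<lambda>s. inv s) ws)) \<one> \<otimes> foldr (\<otimes>) [inv x] \<one>"
    using Cons.prems by (intro foldr_mult) auto
  then show ?case
    using Cons by (simp add: inv_mult_group foldr_closed del: foldr_append)
qed simp

lemma spells_closed: "S \<subseteq> carrier G \<Longrightarrow> spells S ws g \<Longrightarrow> set ws \<subseteq> carrier G"
  by (auto simp: spells_def)

lemma spells_mult:
  assumes "S \<subseteq> carrier G" "spells S ws g" "spells S vs h"
  shows "spells S (ws @ vs) (g \<otimes> h)"
  using assms foldr_mult[of ws vs] spells_closed[of S]
  by (auto simp: spells_def simp del: foldr_append)

lemma spells_inv:
  assumes S: "S \<subseteq> carrier G" and ws: "spells S ws g"
  shows "spells S (rev (map (\<lambda>s. inv s) ws)) (inv g)"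
proof -
  have "(\<lambda>s. inv s) ` (S \<union> (\<lambda>s. inv s) ` S) \<subseteq> S \<union> (\<lambda>s. inv s) ` S"
    using S by (auto simp: subset_iff)
  moreover have "set ws \<subseteq> S \<union> (\<lambda>s. inv s) ` S"
    using ws by (simp add: spells_def)
  ultimately have "(\<lambda>s. inv s) ` set ws \<subseteq> S \<union> (\<lambda>s. inv s) ` S"
    by (meson image_mono order_trans)
  then show ?thesis
    using ws foldr_inv[OF spells_closed[OF S ws]] by (simp add: spells_def)
qed

lemma generate_spells:
  assumes S: "S \<subseteq> carrier G"
  shows "g \<in> generate G S \<Longrightarrow> \<exists>ws. spells S ws g"
proof (induction rule: generate.induct)
  case one
  show ?case by (rule exI[of _ "[]"]) (simp add: spells_def)
next
  case (incl h)
  then show ?case using S by (intro exI[of _ "[h]"]) (auto simp: spells_def)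
next
  case (inv h)
  then show ?case using S by (intro exI[of _ "[inv h]"]) (auto simp: spells_def)
next
  case (eng g h)
  then show ?case using spells_mult[OF S] by blast
qed

lemma word_length_witness:
  assumes "S \<subseteq> carrier G" "generate G S = carrier G" "g \<in> carrier G"
  obtains ws where "length ws = word_length G S g" "spells S ws g"
proof -
  have "\<exists>n ws. length ws = n \<and> spells S ws g"
    using generate_spells[of S g] assms by blast
  then have "\<exists>ws. length ws = word_length G S g \<and> spells S ws g"
    unfolding word_length_spells by (rule LeastI_ex)
  then show ?thesis
    using that by blast
qed

lemma Metric_space_word_dist:
  assumes S: "S \<subseteq> carrier G" "generate G S = carrier G"
  shows "Metric_space (carrier G) (word_dist G S)"
proof
  have inv_le: "word_length G S (inv g) \<le> word_length G S g" if "g \<in> carrier G" for g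
    using word_length_witness[OF S that] spells_inv[OF S(1)] word_length_le
    by (metis length_map length_rev)
  have inv_eq: "word_length G S (inv g) = word_length G S g" if "g \<in> carrier G" for g
    using inv_le[OF that] inv_le[of "inv g"] that by simp
  fix x y z
  show "0 \<le> word_dist G S x y"
    by (simp add: word_dist_def)
  show "word_dist G S x y = word_dist G S y x"
    using inv_eq[of "inv x \<otimes> y"] by (auto simp: word_dist_def inv_mult_group)
  assume x: "x \<in> carrier G" and y: "y \<in> carrier G"
  show "(word_dist G S x y = 0) = (x = y)"
  proof
    assume "word_dist G S x y = 0"
    then have 0: "word_length G S (inv x \<otimes> y) = 0"
      using x y by (simp add: word_dist_def)
    obtain ws where "length ws = word_length G S (inv x \<otimes> y)" "spells S ws (inv x \<otimes> y)"
      using word_length_witness[OF S, of "inv x \<otimes> y"] x y by auto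
    with 0 have "inv x \<otimes> y = \<one>"
      by (simp add: spells_def)
    then show "x = y"
      using x y by (metis inv_closed inv_equality inv_inv)
  next
    assume "x = y"
    moreover have "word_length G S \<one> = 0"
      using word_length_le[of S "[]" \<one>] by (simp add: spells_def)
    ultimately show "word_dist G S x y = 0"
      using x by (simp add: word_dist_def)
  qed
  assume z: "z \<in> carrier G"
  obtain ws where ws: "length ws = word_length G S (inv x \<otimes> y)" "spells S ws (inv x \<otimes> y)"
    using word_length_witness[OF S, of "inv x \<otimes> y"] x y by auto
  obtain vs where vs: "length vs = word_length G S (inv y \<otimes> z)" "spells S vs (inv y \<otimes> z)"
    using word_length_witness[OF S, of "inv y \<otimes> z"] y z by auto
  have "(inv x \<otimes> y) \<otimes> (inv y \<otimes> z) = inv x \<otimes> z"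
    using x y z by (metis inv_closed inv_solve_left m_assoc m_closed)
  then have "word_length G S (inv x \<otimes> z) \<le> length (ws @ vs)"
    using spells_mult[OF S(1) ws(2) vs(2)] word_length_le by metis
  then show "word_dist G S x z \<le> word_dist G S x y + word_dist G S y z"
    using x y z ws(1) vs(1) by (simp add: word_dist_def)
qed

end

definition thompson_dist :: "nat word set \<Rightarrow> nat word set \<Rightarrow> real" where
  "thompson_dist = word_dist thompson_F {thompson_gen 0, thompson_gen 1}"

lemma Metric_space_thompson: "Metric_space (carrier thompson_F) thompson_dist"
  unfolding thompson_dist_def
  by (rule group.Metric_space_word_dist[OF group_thompson_F _ thompson_generated])
    (simp add: thompson_gen_closed)


section \<open>Ultralimits and asymptotic cones\<close>

definition ultrafilter :: "'i filter \<Rightarrow> bool" where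
  "ultrafilter \<omega> \<longleftrightarrow> \<omega> \<noteq> bot \<and> (\<forall>P. eventually P \<omega> \<or> eventually (\<lambda>m. \<not> P m) \<omega>)"

definition nonprincipal_ultrafilter :: "'i filter \<Rightarrow> bool" where
  "nonprincipal_ultrafilter \<omega> \<longleftrightarrow> ultrafilter \<omega> \<and> (\<forall>m. \<omega> \<noteq> principal {m})"

text \<open>
  The ultralimit along \<open>\<omega>\<close> of the pointed metric spaces \<open>(X, d m, b)\<close>, which share the carrier \<open>X\<close>
  and the base point \<open>b\<close>.
\<close>

definition ultralimit_seqs :: "'a set \<Rightarrow> (nat \<Rightarrow> 'a \<Rightarrow> 'a \<Rightarrow> real) \<Rightarrow> 'a \<Rightarrow> (nat \<Rightarrow> 'a) set" where
  "ultralimit_seqs X d b = {g. (\<forall>m. g m \<in> X) \<and> bounded (range (\<lambda>m. d m b (g m)))}"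

definition ultralimit_rel ::
    "nat filter \<Rightarrow> 'a set \<Rightarrow> (nat \<Rightarrow> 'a \<Rightarrow> 'a \<Rightarrow> real) \<Rightarrow> 'a \<Rightarrow> ((nat \<Rightarrow> 'a) \<times> (nat \<Rightarrow> 'a)) set" where
  "ultralimit_rel \<omega> X d b =
    {(g, h). g \<in> ultralimit_seqs X d b \<and> h \<in> ultralimit_seqs X d b
      \<and> ((\<lambda>m. d m (g m) (h m)) \<longlongrightarrow> 0) \<omega>}"

definition ultralimit_space ::
    "nat filter \<Rightarrow> 'a set \<Rightarrow> (nat \<Rightarrow> 'a \<Rightarrow> 'a \<Rightarrow> real) \<Rightarrow> 'a \<Rightarrow> (nat \<Rightarrow> 'a) set set" where
  "ultralimit_space \<omega> X d b = ultralimit_seqs X d b // ultralimit_rel \<omega> X d b"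

definition ultralimit_dist ::
    "nat filter \<Rightarrow> 'a set \<Rightarrow> (nat \<Rightarrow> 'a \<Rightarrow> 'a \<Rightarrow> real) \<Rightarrow> 'a \<Rightarrow> (nat \<Rightarrow> 'a) set \<Rightarrow> (nat \<Rightarrow> 'a) set \<Rightarrow> real" where
  "ultralimit_dist \<omega> X d b A B =
    (if A \<in> ultralimit_space \<omega> X d b \<and> B \<in> ultralimit_space \<omega> X d b
     then the_elem ((\<lambda>(g, h). Lim \<omega> (\<lambda>m. d m (g m) (h m))) ` (A \<times> B)) else 0)"

lemma ultrafilter_convergent:
  fixes f :: "'i \<Rightarrow> real"
  assumes "ultrafilter \<omega>" "bounded (range f)"
  obtains l where "(f \<longlongrightarrow> l) \<omega>"
proof -
  let ?F = "filtermap f \<omega>"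
  have bot: "?F \<noteq> bot"
    using assms(1) by (simp add: ultrafilter_def filtermap_bot_iff)
  have "eventually (\<lambda>x. x \<in> closure (range f)) ?F"
    by (simp add: eventually_filtermap closure_subset[THEN subsetD])
  moreover have "compact (closure (range f))"
    using assms(2) by (simp add: compact_closure)
  ultimately obtain l where l: "inf (nhds l) ?F \<noteq> bot"
    using bot unfolding compact_filter by metis
  have "(f \<longlongrightarrow> l) \<omega>"
  proof (rule topological_tendstoI)
    fix U assume U: "open U" "l \<in> U"
    show "\<forall>\<^sub>F x in \<omega>. f x \<in> U"
    proof (rule ccontr)
      assume "\<not> (\<forall>\<^sub>F x in \<omega>. f x \<in> U)"
      then have "\<forall>\<^sub>F x in \<omega>. f x \<notin> U"
        using assms(1) by (auto simp: ultrafilter_def)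
      then have "\<forall>\<^sub>F x in ?F. x \<notin> U"
        by (simp add: eventually_filtermap)
      moreover have "\<forall>\<^sub>F x in nhds l. x \<in> U"
        using U by (rule eventually_nhds_in_open)
      ultimately have "eventually (\<lambda>_. False) (inf (nhds l) ?F)"
        unfolding eventually_inf by blast
      then show False
        using l by (simp add: trivial_limit_def)
    qed
  qed
  then show ?thesis by (rule that)
qed

locale ultralimit =
  fixes \<omega> :: "nat filter" and X :: "'a set" and d :: "nat \<Rightarrow> 'a \<Rightarrow> 'a \<Rightarrow> real" and b :: 'a
  assumes ultrafilter: "ultrafilter \<omega>"
    and metric: "\<And>m. Metric_space X (d m)"
    and base: "b \<in> X"
begin

abbreviation "seqs \<equiv> ultralimit_seqs X d b"
abbreviation "rel \<equiv> ultralimit_rel \<omega> X d b"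

lemma nontrivial: "\<omega> \<noteq> bot"
  using ultrafilter by (simp add: ultrafilter_def)

lemma seq_in: "g \<in> seqs \<Longrightarrow> g m \<in> X"
  by (simp add: ultralimit_seqs_def)

lemma tri:
  assumes "f \<in> seqs" "g \<in> seqs" "h \<in> seqs"
  shows "d m (f m) (h m) \<le> d m (f m) (g m) + d m (g m) (h m)"
  using assms by (intro Metric_space.triangle[OF metric] seq_in)

lemma dist_tendsto:
  assumes g: "g \<in> seqs" and h: "h \<in> seqs"
  shows "((\<lambda>m. d m (g m) (h m)) \<longlongrightarrow> Lim \<omega> (\<lambda>m. d m (g m) (h m))) \<omega>"
proof -
  obtain B where B: "\<And>m. \<bar>d m b (g m)\<bar> \<le> B"
    using g by (auto simp: ultralimit_seqs_def bounded_iff)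
  obtain C where C: "\<And>m. \<bar>d m b (h m)\<bar> \<le> C"
    using h by (auto simp: ultralimit_seqs_def bounded_iff)
  have "\<bar>d m (g m) (h m)\<bar> \<le> B + C" for m
    using Metric_space.triangle''[OF metric seq_in[OF g] base seq_in[OF h], of m m m] B[of m] C[of m]
      Metric_space.nonneg[OF metric[of m], of "g m" "h m"]
    by linarith
  then have "bounded (range (\<lambda>m. d m (g m) (h m)))"
    unfolding bounded_iff by (intro exI[of _ "B + C"]) simp
  then obtain l where l: "((\<lambda>m. d m (g m) (h m)) \<longlongrightarrow> l) \<omega>"
    by (rule ultrafilter_convergent[OF ultrafilter])
  then show ?thesis
    by (simp add: tendsto_Lim[OF nontrivial])
qed

lemma relD:
  assumes "(g, h) \<in> rel"
  shows "g \<in> seqs" "h \<in> seqs" "((\<lambda>m. d m (g m) (h m)) \<longlongrightarrow> 0) \<omega>"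
  using assms by (simp_all add: ultralimit_rel_def)

lemma relI:
  "g \<in> seqs \<Longrightarrow> h \<in> seqs \<Longrightarrow> ((\<lambda>m. d m (g m) (h m)) \<longlongrightarrow> 0) \<omega> \<Longrightarrow> (g, h) \<in> rel"
  by (simp add: ultralimit_rel_def)

lemma dist_commute: "(\<lambda>m. d m (g m) (h m)) = (\<lambda>m. d m (h m) (g m))"
  using Metric_space.commute[OF metric] by (intro ext)

lemma equiv_rel: "equiv seqs rel"
proof (rule equivI)
  show "rel \<subseteq> seqs \<times> seqs"
    by (rule subrelI) (blast dest: relD)
  show "refl_on seqs rel"
  proof (rule refl_onI)
    fix g assume g: "g \<in> seqs"
    have "(\<lambda>m. d m (g m) (g m)) = (\<lambda>m. 0)"
      using Metric_space.mdist_zero[OF metric seq_in[OF g]] by (intro ext)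
    then show "(g, g) \<in> rel"
      by (intro relI g) simp
  qed
  show "sym rel"
  proof (rule symI)
    fix g h assume "(g, h) \<in> rel"
    from relD[OF this] show "(h, g) \<in> rel"
      by (intro relI) (simp_all add: dist_commute[of h g])
  qed
  show "trans rel"
  proof (rule transI)
    fix f g h assume fg: "(f, g) \<in> rel" and gh: "(g, h) \<in> rel"
    note s = relD(1)[OF fg] relD(1)[OF gh] relD(2)[OF gh]
    have "((\<lambda>m. d m (f m) (g m) + d m (g m) (h m)) \<longlongrightarrow> 0) \<omega>"
      using tendsto_add[OF relD(3)[OF fg] relD(3)[OF gh]] by simp
    then have "((\<lambda>m. d m (f m) (h m)) \<longlongrightarrow> 0) \<omega>"
      by (rule tendsto_sandwich[OF always_eventually always_eventually tendsto_const, rotated 2])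
        (simp_all add: tri[OF s] Metric_space.nonneg[OF metric])
    then show "(f, h) \<in> rel"
      using s by (intro relI)
  qed
qed

lemma Lim_cong:
  assumes "(g, g') \<in> rel" "(h, h') \<in> rel"
  shows "Lim \<omega> (\<lambda>m. d m (g m) (h m)) = Lim \<omega> (\<lambda>m. d m (g' m) (h' m))"
proof -
  have le: "Lim \<omega> (\<lambda>m. d m (g m) (h m)) \<le> Lim \<omega> (\<lambda>m. d m (g' m) (h' m))"
    if g: "(g, g') \<in> rel" and h: "(h', h) \<in> rel" for g g' h h'
  proof -
    note s = relD(1,2)[OF g] relD(2,1)[OF h]
    have 1: "((\<lambda>m. d m (g m) (g' m) + (d m (g' m) (h' m) + d m (h' m) (h m)))
        \<longlongrightarrow> 0 + (Lim \<omega> (\<lambda>m. d m (g' m) (h' m)) + 0)) \<omega>"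
      by (intro tendsto_add dist_tendsto relD(3)[OF g] relD(3)[OF h] s)
    have "d m (g m) (h m) \<le> d m (g m) (g' m) + (d m (g' m) (h' m) + d m (h' m) (h m))" for m
      using tri[OF s(1,2,3), of m] tri[OF s(2,4,3), of m] by linarith
    then show ?thesis
      using tendsto_le[OF nontrivial 1 dist_tendsto[OF s(1,3)]] by simp
  qed
  have "sym rel"
    using equiv_rel by (simp add: equiv_def)
  from symD[OF this assms(1)] symD[OF this assms(2)] show ?thesis
    using le assms by (intro order.antisym) blast+
qed

lemma ultralimit_dist_class:
  assumes g: "g \<in> seqs" and h: "h \<in> seqs"
  shows "ultralimit_dist \<omega> X d b (rel `` {g}) (rel `` {h}) = Lim \<omega> (\<lambda>m. d m (g m) (h m))"
proof -
  have "the_elem ((\<lambda>(g, h). Lim \<omega> (\<lambda>m. d m (g m) (h m))) ` (rel `` {g} \<times> rel `` {h}))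
      = Lim \<omega> (\<lambda>m. d m (g m) (h m))"
  proof (rule the_elem_image_unique)
    show "rel `` {g} \<times> rel `` {h} \<noteq> {}"
      using equiv_class_self[OF equiv_rel g] equiv_class_self[OF equiv_rel h] by blast
  next
    fix p assume "p \<in> rel `` {g} \<times> rel `` {h}"
    then obtain g' h' where "p = (g', h')" "(g, g') \<in> rel" "(h, h') \<in> rel"
      by blast
    then show "(case p of (g, h) \<Rightarrow> Lim \<omega> (\<lambda>m. d m (g m) (h m))) = Lim \<omega> (\<lambda>m. d m (g m) (h m))"
      using Lim_cong[of g g' h h'] by simp
  qed
  then show ?thesis
    using g h by (simp add: ultralimit_dist_def ultralimit_space_def quotientI)
qed

lemma Metric_space_ultralimit: "Metric_space (ultralimit_space \<omega> X d b) (ultralimit_dist \<omega> X d b)"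
proof -
  let ?M = "ultralimit_space \<omega> X d b" and ?D = "ultralimit_dist \<omega> X d b"
  have rep: "\<exists>g\<in>seqs. A = rel `` {g}" if "A \<in> ?M" for A
    using that by (auto simp: ultralimit_space_def elim: quotientE)
  have off: "?D A B = 0" if "A \<notin> ?M \<or> B \<notin> ?M" for A B
    using that by (auto simp: ultralimit_dist_def)
  show ?thesis
  proof
    fix A B C
    show "0 \<le> ?D A B"
    proof (cases "A \<in> ?M \<and> B \<in> ?M")
      case True
      then obtain g h where gh: "g \<in> seqs" "A = rel `` {g}" "h \<in> seqs" "B = rel `` {h}"
        using rep[of A] rep[of B] by blast
      then show ?thesis
        using tendsto_lowerbound[OF dist_tendsto[OF gh(1,3)] always_eventually nontrivial, of 0]
        by (simp add: ultralimit_dist_class Metric_space.nonneg[OF metric])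
    qed (use off in auto)
    show "?D A B = ?D B A"
    proof (cases "A \<in> ?M \<and> B \<in> ?M")
      case True
      then obtain g h where gh: "g \<in> seqs" "A = rel `` {g}" "h \<in> seqs" "B = rel `` {h}"
        using rep[of A] rep[of B] by blast
      then show ?thesis
        using gh by (simp add: ultralimit_dist_class dist_commute[of h g])
    qed (use off in auto)
    assume "A \<in> ?M" and "B \<in> ?M"
    then obtain g h where gh: "g \<in> seqs" "A = rel `` {g}" "h \<in> seqs" "B = rel `` {h}"
      using rep[of A] rep[of B] by blast
    have "Lim \<omega> (\<lambda>m. d m (g m) (h m)) = 0 \<longleftrightarrow> (g, h) \<in> rel"
    proof
      assume "Lim \<omega> (\<lambda>m. d m (g m) (h m)) = 0"
      then show "(g, h) \<in> rel"
        using dist_tendsto[OF gh(1,3)] by (intro relI gh) simp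
    next
      assume "(g, h) \<in> rel"
      then show "Lim \<omega> (\<lambda>m. d m (g m) (h m)) = 0"
        by (intro tendsto_Lim[OF nontrivial] relD)
    qed
    then show "?D A B = 0 \<longleftrightarrow> A = B"
      using gh eq_equiv_class_iff[OF equiv_rel gh(1,3)] by (simp add: ultralimit_dist_class)
    assume "C \<in> ?M"
    then obtain k where k: "k \<in> seqs" "C = rel `` {k}"
      using rep[of C] by blast
    have "Lim \<omega> (\<lambda>m. d m (g m) (k m)) \<le> Lim \<omega> (\<lambda>m. d m (g m) (h m)) + Lim \<omega> (\<lambda>m. d m (h m) (k m))"
      by (rule tendsto_le[OF nontrivial tendsto_add[OF dist_tendsto[OF gh(1,3)] dist_tendsto[OF gh(3) k(1)]]
            dist_tendsto[OF gh(1) k(1)]])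
        (intro always_eventually allI tri gh k)
    then show "?D A C \<le> ?D A B + ?D B C"
      using gh k by (simp add: ultralimit_dist_class)
  qed
qed

end

definition thompson_cone_space :: "nat filter \<Rightarrow> (nat \<Rightarrow> real) \<Rightarrow> (nat \<Rightarrow> nat word set) set set" where
  "thompson_cone_space \<omega> s =
    ultralimit_space \<omega> (carrier thompson_F) (\<lambda>m g h. thompson_dist g h / s m) \<one>\<^bsub>thompson_F\<^esub>"

definition thompson_cone_dist ::
    "nat filter \<Rightarrow> (nat \<Rightarrow> real) \<Rightarrow> (nat \<Rightarrow> nat word set) set \<Rightarrow> (nat \<Rightarrow> nat word set) set \<Rightarrow> real" where
  "thompson_cone_dist \<omega> s =
    ultralimit_dist \<omega> (carrier thompson_F) (\<lambda>m g h. thompson_dist g h / s m) \<one>\<^bsub>thompson_F\<^esub>"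

lemma Metric_space_thompson_cone:
  assumes "ultrafilter \<omega>" "\<And>m. 0 < s m"
  shows "Metric_space (thompson_cone_space \<omega> s) (thompson_cone_dist \<omega> s)"
proof -
  interpret F: Metric_space "carrier thompson_F" thompson_dist
    by (rule Metric_space_thompson)
  have "Metric_space (carrier thompson_F) (\<lambda>g h. thompson_dist g h / s m)" for m
  proof
    fix x y z
    show "0 \<le> thompson_dist x y / s m" "thompson_dist x y / s m = thompson_dist y x / s m"
      using assms(2)[of m] F.commute by (simp_all add: less_imp_le)
    assume "x \<in> carrier thompson_F" "y \<in> carrier thompson_F"
    then show "thompson_dist x y / s m = 0 \<longleftrightarrow> x = y"
      using assms(2)[of m] by simp
    assume "z \<in> carrier thompson_F"
    with \<open>x \<in> _\<close> \<open>y \<in> _\<close> show "thompson_dist x z / s m \<le> thompson_dist x y / s m + thompson_dist y z / s m"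
      using assms(2)[of m] F.triangle[of x y z]
      by (simp add: add_divide_distrib[symmetric] divide_right_mono)
  qed
  then interpret ultralimit \<omega> "carrier thompson_F" "\<lambda>m g h. thompson_dist g h / s m" "\<one>\<^bsub>thompson_F\<^esub>"
    by (rule ultralimit.intro[OF assms(1)])
      (rule monoid.one_closed[OF group.is_monoid[OF group_thompson_F]])
  show ?thesis
    unfolding thompson_cone_space_def thompson_cone_dist_def by (rule Metric_space_ultralimit)
qed


section \<open>Covering dimension\<close>

text \<open>
  The Cech-Lebesgue convention of finite open covers; for metrizable spaces, arbitrary open covers
  give the same dimension.
\<close>

definition covering_dim_le :: "'a topology \<Rightarrow> nat \<Rightarrow> bool" where
  "covering_dim_le T n \<longleftrightarrow>
    (\<forall>\<U>. finite \<U> \<and> (\<forall>U\<in>\<U>. openin T U) \<and> \<Union>\<U> = topspace T \<longrightarrow>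
      (\<exists>\<V>. (\<forall>V\<in>\<V>. openin T V \<and> (\<exists>U\<in>\<U>. V \<subseteq> U)) \<and> \<Union>\<V> = topspace T \<and>
        (\<forall>x\<in>topspace T. finite {V \<in> \<V>. x \<in> V} \<and> card {V \<in> \<V>. x \<in> V} \<le> n + 1)))"

text \<open>
  The infimum of the empty set is \<open>\<infinity>\<close>.  Being a natural number or \<open>\<infinity>\<close>, the dimension of the
  empty space comes out as 0 rather than the customary -1.
\<close>

definition covering_dim :: "'a topology \<Rightarrow> enat" where
  "covering_dim T = (INF n\<in>{n. covering_dim_le T n}. enat n)"

end

theory Submission
  imports Defs
begin

text \<open>
  A space has covering dimension greater than \<open>n\<close> as soon as the identity of the cube \<open>[0,1]\<^sup>n\<^sup>+\<^sup>1\<close>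
  factors continuously through it, as a map from the cube into the space followed by \<open>n + 1\<close>
  real-valued coordinate functions on the space: a cover by sets that miss one of each pair of
  opposite faces pulls back from the coordinates to the space, any refinement of it pulls back further
  to the cube, and there the Lebesgue covering theorem forces \<open>n + 2\<close> sets to meet
  (\<open>not_covering_dim_le_of_cube_factor\<close>).  So it is enough to factor every cube through the cone.

  For this, let \<open>F\<close> act from the right on the half line \<open>[0,\<infinity>)\<close>, with \<open>x\<^sub>k\<close> the identity on \<open>[0,k]\<close>,
  of slope 2 on \<open>[k,k+1]\<close>, and the translation by 1 beyond.  By the chain rule, multiplying an element
  by a generator on the right changes the logarithm of its right-hand slope at any fixed point by at most 1.
  These logarithms are therefore 1-Lipschitz functions on \<open>F\<close> (\<open>log_slope_Lipschitz\<close>), and they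
  descend to the cone.  On the other hand the elements \<open>x\<^sub>2\<^sub>i x\<^sub>2\<^sub>i\<^sub>+\<^sub>1\<^sup>-\<^sup>1\<close> commute, because their supports
  \<open>[2i,2i+2]\<close> do not overlap, and the one with index \<open>i\<close> fixes every even integer and doubles the
  right-hand slope at \<open>2j\<close> exactly if \<open>i = j\<close>.  Hence the logarithmic slopes at
  \<open>0, 2, 4, \<dots>\<close> read off the exponents of a product of these commuting elements, while the product
  depends in a Lipschitz way on the exponents (\<open>bump_product_Lipschitz\<close>).  Rescaled by \<open>s\<close>,
  integer exponents become real coordinates in the limit, and the cube factors as wanted.
\<close>

section \<open>The Lebesgue covering theorem\<close>

text \<open>
  The cubes of all dimensions live in the single space of real sequences, so that the dimension \<open>n\<close>
  can be an ordinary number.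
\<close>

definition unit_cube :: "nat \<Rightarrow> (nat \<Rightarrow> real) set" where
  "unit_cube n = {x. (\<forall>i<n. 0 \<le> x i \<and> x i \<le> 1) \<and> (\<forall>i\<ge>n. x i = 0)}"

lemma compact_unit_cube: "compact (unit_cube n)"
proof -
  have "compactin (product_topology (\<lambda>i. euclidean) UNIV)
      (PiE UNIV (\<lambda>i. if i < n then {0..1} else {0::real}))"
    by (simp add: compactin_PiE)
  moreover have "PiE UNIV (\<lambda>i. if i < n then {0..1} else {0::real}) = unit_cube n"
    by (auto simp: unit_cube_def PiE_iff split: if_splits)
  ultimately show ?thesis
    by (simp add: euclidean_product_topology)
qed

lemma tendsto_coordinatewise:
  fixes f :: "'b \<Rightarrow> nat \<Rightarrow> real"
  assumes "\<And>i. ((\<lambda>a. f a i) \<longlongrightarrow> l i) F"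
  shows "(f \<longlongrightarrow> l) F"
  using assms limitin_componentwise[of "\<lambda>i::nat. euclideanreal" UNIV f l F]
  by (simp add: euclidean_product_topology limitin_canonical_iff)

definition grid_point :: "nat \<Rightarrow> nat \<Rightarrow> (nat \<Rightarrow> nat) \<Rightarrow> nat \<Rightarrow> real" where
  "grid_point n p q = (\<lambda>i. if i < n then real (q i) / real p else 0)"

lemma grid_point_in_cube:
  assumes "\<And>i. i < n \<Longrightarrow> q i \<le> p"
  shows "grid_point n p q \<in> unit_cube n"
  using assms by (cases "p = 0") (auto simp: grid_point_def unit_cube_def)

text \<open>
  The cells of ever finer grids shrink to points: if one corner of the cells converges along a
  subsequence, then so does any choice of vertices.  The mesh at stage \<open>p\<close> is \<open>1 / Suc p\<close>.
\<close>

lemma grid_neighbours_tendsto: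
  assumes r: "strict_mono (r :: nat \<Rightarrow> nat)"
    and lim: "(\<lambda>k. grid_point n (Suc (r k)) (q (r k))) \<longlonglongrightarrow> l"
    and near: "\<And>k i. i < n \<Longrightarrow> q (r k) i \<le> u k i \<and> u k i \<le> q (r k) i + 1"
  shows "(\<lambda>k. grid_point n (Suc (r k)) (u k)) \<longlonglongrightarrow> l"
proof (rule tendsto_coordinatewise)
  fix i
  have li: "(\<lambda>k. grid_point n (Suc (r k)) (q (r k)) i) \<longlonglongrightarrow> l i"
    using continuous_on_tendsto_compose[OF continuous_on_product_coordinates lim] by simp
  have "(\<lambda>k. 1 / real (Suc (r k))) \<longlonglongrightarrow> 0"
    using LIMSEQ_subseq_LIMSEQ[OF LIMSEQ_inverse_real_of_nat r]
    by (simp add: o_def inverse_eq_divide)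
  from tendsto_add[OF li this]
  have up: "(\<lambda>k. grid_point n (Suc (r k)) (q (r k)) i + 1 / real (Suc (r k))) \<longlonglongrightarrow> l i"
    by simp
  have *: "grid_point n (Suc (r k)) (q (r k)) i \<le> grid_point n (Suc (r k)) (u k) i
      \<and> grid_point n (Suc (r k)) (u k) i
        \<le> grid_point n (Suc (r k)) (q (r k)) i + 1 / real (Suc (r k))" for k
  proof (cases "i < n")
    case True
    have "real (q (r k) i) \<le> real (u k i)" "real (u k i) \<le> real (q (r k) i) + 1"
      using near[OF True, of k] by linarith+
    then show ?thesis
      using True by (auto simp: grid_point_def divide_right_mono simp flip: add_divide_distrib)
  qed (simp add: grid_point_def)
  show "(\<lambda>k. grid_point n (Suc (r k)) (u k) i) \<longlonglongrightarrow> l i"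
    by (rule tendsto_sandwich[OF always_eventually always_eventually li up]) (use * in auto)
qed

lemma open_positivity_function:
  fixes V :: "'a::metric_space set"
  assumes "open V"
  obtains f :: "'a \<Rightarrow> real" where "continuous_on UNIV f" "\<And>x. 0 \<le> f x" "\<And>x. 0 < f x \<longleftrightarrow> x \<in> V"
proof (cases "V = UNIV")
  case True
  \<comment> \<open>The distance to the complement fails here: the distance to the empty set is 0.\<close>
  show ?thesis by (rule that[of "\<lambda>_. 1"]) (auto simp: True)
next
  case False
  have *: "0 < infdist x (- V) \<longleftrightarrow> x \<in> V" for x
    using in_closed_iff_infdist_zero[of "- V" x] assms False infdist_nonneg[of x "- V"]
    by (auto simp: closed_Compl less_le)
  show ?thesis
    by (rule that[of "\<lambda>x. infdist x (- V)"])
      (auto intro!: continuous_on_infdist simp: infdist_nonneg *)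
qed

text \<open>
  The number of sets is first traded for colours.  Choose functions \<open>f i\<close> that are positive exactly on
  \<open>V i\<close>, and for a set \<open>\<sigma>\<close> of indices let \<open>W \<sigma>\<close> consist of the points at which every \<open>f i\<close> with \<open>i \<in> \<sigma>\<close>
  is positive and exceeds all \<open>f k\<close> with \<open>k \<notin> \<sigma>\<close>.  (These are the open stars of the barycentres in the
  subdivided nerve.)  The sets \<open>W \<sigma>\<close> with \<open>\<sigma>\<close> of a given size are pairwise disjoint, and those with
  \<open>\<sigma>\<close> of size \<open>1, \<dots>, n\<close> cover the cube: there are as many colours as coordinate directions.

  Now suppose that no \<open>V i\<close> meets two opposite faces.  In direction \<open>j\<close>, label a grid point 0 if it lies
  in a set of colour \<open>j\<close> that reaches the face \<open>x j = 0\<close>, and 1 otherwise.  Kuhn's lemma yields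
  arbitrarily small grid cells on which the labels in every direction take both values.  But a cell
  that is small enough lies in one set \<open>W \<sigma>\<close>, of colour \<open>j\<close> say, and is disjoint from the other sets
  of this colour, so that its labels in direction \<open>j\<close> are constant.
\<close>

theorem Lebesgue_covering:
  fixes V :: "'i \<Rightarrow> (nat \<Rightarrow> real) set"
  assumes I: "finite I" and opn: "\<And>i. i \<in> I \<Longrightarrow> open (V i)"
    and cover: "unit_cube n \<subseteq> (\<Union>i\<in>I. V i)"
    and order: "\<And>x. x \<in> unit_cube n \<Longrightarrow> card {i \<in> I. x \<in> V i} \<le> n"
  obtains i j x y where "i \<in> I" "j < n" "x \<in> V i \<inter> unit_cube n" "x j = 0"
    "y \<in> V i \<inter> unit_cube n" "y j = 1"
proof (rule ccontr)
  assume "\<not> thesis"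
  with that have sep: False
    if "i \<in> I" "j < n" "x \<in> V i" "x \<in> unit_cube n" "x j = 0" "y \<in> V i" "y \<in> unit_cube n" "y j = 1"
    for i j x y using that by blast
  have "\<forall>i\<in>I. \<exists>f :: (nat \<Rightarrow> real) \<Rightarrow> real. continuous_on UNIV f \<and> (\<forall>x. 0 \<le> f x) \<and> (\<forall>x. 0 < f x \<longleftrightarrow> x \<in> V i)"
    using open_positivity_function[OF opn] by metis
  then obtain f :: "'i \<Rightarrow> (nat \<Rightarrow> real) \<Rightarrow> real"
    where "\<forall>i\<in>I. continuous_on UNIV (f i) \<and> (\<forall>x. 0 \<le> f i x) \<and> (\<forall>x. 0 < f i x \<longleftrightarrow> x \<in> V i)"
    by (rule bchoice[THEN exE])
  then have f_cont: "\<And>i. i \<in> I \<Longrightarrow> continuous_on UNIV (f i)"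
    and f_nonneg: "\<And>i x. i \<in> I \<Longrightarrow> 0 \<le> f i x"
    and f_pos: "\<And>i x. i \<in> I \<Longrightarrow> 0 < f i x \<longleftrightarrow> x \<in> V i"
    by blast+
  define W where "W \<sigma> = (\<Inter>i\<in>\<sigma>. {x. 0 < f i x} \<inter> (\<Inter>k\<in>I - \<sigma>. {x. f k x < f i x}))" for \<sigma>
  have W_open: "open (W \<sigma>)" if "\<sigma> \<subseteq> I" for \<sigma>
    unfolding W_def using that I finite_subset[OF that I]
    by (intro open_INT ballI open_Int open_Collect_less continuous_on_const f_cont) auto
  have W_sub: "W \<sigma> \<subseteq> V i" if "\<sigma> \<subseteq> I" "i \<in> \<sigma>" for \<sigma> i
    using that f_pos unfolding W_def by auto
  have W_eq: "\<sigma> = \<tau>" if s: "\<sigma> \<subseteq> I" "\<tau> \<subseteq> I" "card \<sigma> = card \<tau>" "x \<in> W \<sigma>" "x \<in> W \<tau>" for \<sigma> \<tau> x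
  proof (rule ccontr)
    assume "\<sigma> \<noteq> \<tau>"
    have fin: "finite \<sigma>" "finite \<tau>"
      using finite_subset I s by blast+
    \<comment> \<open>Sets of equal size that differ are incomparable, which gives contradictory inequalities.\<close>
    have "\<not> \<sigma> \<subseteq> \<tau>" "\<not> \<tau> \<subseteq> \<sigma>"
      using card_subset_eq[OF fin(2), of \<sigma>] card_subset_eq[OF fin(1), of \<tau>] \<open>\<sigma> \<noteq> \<tau>\<close> s(3) by auto
    then obtain i k where "i \<in> \<sigma> - \<tau>" "k \<in> \<tau> - \<sigma>"
      by blast
    then have "f k x < f i x" "f i x < f k x"
      using s unfolding W_def by auto
    then show False by simp
  qed
  have W_cover: "\<exists>\<sigma> j. \<sigma> \<subseteq> I \<and> card \<sigma> = Suc j \<and> j < n \<and> x \<in> W \<sigma>" if x: "x \<in> unit_cube n" for x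
  proof -
    \<comment> \<open>All functions \<open>f k\<close> with \<open>x \<notin> V k\<close> vanish at \<open>x\<close>, so the full set of indices at \<open>x\<close> works.\<close>
    let ?\<sigma> = "{i \<in> I. x \<in> V i}"
    have "f k x < f i x" if "i \<in> ?\<sigma>" "k \<in> I - ?\<sigma>" for i k
      using that f_pos[of i x] f_pos[of k x] f_nonneg[of k x] by auto
    then have "x \<in> W ?\<sigma>"
      unfolding W_def using f_pos by auto
    moreover have "?\<sigma> \<noteq> {}"
      using cover x by auto
    then have "card ?\<sigma> > 0"
      using I by (simp add: card_gt_0_iff)
    then obtain j where "card ?\<sigma> = Suc j"
      by (metis gr0_implies_Suc)
    ultimately show ?thesis
      using order[OF x] by (intro exI[of _ ?\<sigma>] exI[of _ j]) auto
  qed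
  \<comment> \<open>Colours are numbered from 0, like the directions: colour \<open>j\<close> is size \<open>Suc j\<close>.\<close>
  define near where "near j x \<longleftrightarrow> (\<exists>\<sigma>\<subseteq>I. card \<sigma> = Suc j \<and> x \<in> W \<sigma> \<and> (\<exists>y\<in>W \<sigma> \<inter> unit_cube n. y j = 0))"
    for j x
  \<comment> \<open>The alternative \<open>q j = 0\<close> takes care of grid points on the face that no set of colour \<open>j\<close> covers.\<close>
  define label where "label p q j = (if near j (grid_point n p q) \<or> q j = 0 then 0 else 1 :: nat)"
    for p q j
  define adjacent where "adjacent q u \<longleftrightarrow> (\<forall>j<n. q j \<le> u j \<and> u j \<le> q j + 1)" for q u :: "nat \<Rightarrow> nat"
  define split_cell where "split_cell p q \<longleftrightarrow> (\<forall>i<n. q i < Suc p) \<and>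
      (\<forall>i<n. \<exists>u v. adjacent q u \<and> adjacent q v \<and> label (Suc p) u i \<noteq> label (Suc p) v i)" for p q
  have "\<forall>p. \<exists>q. split_cell p q"
  proof
    fix p
    have top: "label (Suc p) q j = 1" if q: "\<forall>i<n. q i \<le> Suc p" "j < n" "q j = Suc p" for q j
    proof -
      have "\<not> near j (grid_point n (Suc p) q)"
      proof
        assume "near j (grid_point n (Suc p) q)"
        then obtain \<sigma> y where *: "\<sigma> \<subseteq> I" "card \<sigma> = Suc j" "grid_point n (Suc p) q \<in> W \<sigma>"
          "y \<in> W \<sigma>" "y \<in> unit_cube n" "y j = 0"
          unfolding near_def by blast
        then obtain i where i: "i \<in> \<sigma>"
          by (metis card.empty equals0I nat.distinct(1))
        have "grid_point n (Suc p) q j = 1"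
          using q by (simp add: grid_point_def)
        then show False
          using sep[of i j y "grid_point n (Suc p) q"] W_sub[OF *(1) i] * i q
            grid_point_in_cube[of n q "Suc p"] by auto
      qed
      then show ?thesis using q by (simp add: label_def)
    qed
    have "0 < Suc p"
      "\<forall>x. (\<forall>i<n. x i \<le> Suc p) \<longrightarrow> (\<forall>i<n. label (Suc p) x i = 0 \<or> label (Suc p) x i = 1)"
      "\<forall>x. (\<forall>i<n. x i \<le> Suc p) \<longrightarrow> (\<forall>i<n. x i = 0 \<longrightarrow> label (Suc p) x i = 0)"
      "\<forall>x. (\<forall>i<n. x i \<le> Suc p) \<longrightarrow> (\<forall>i<n. x i = Suc p \<longrightarrow> label (Suc p) x i = 1)"
      using top by (simp_all add: label_def)
    then obtain q0 where "\<forall>i<n. q0 i < Suc p"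
      "\<forall>i<n. \<exists>u v. (\<forall>j<n. q0 j \<le> u j \<and> u j \<le> q0 j + 1) \<and>
        (\<forall>j<n. q0 j \<le> v j \<and> v j \<le> q0 j + 1) \<and> label (Suc p) u i \<noteq> label (Suc p) v i"
      by (rule kuhn_lemma[of "Suc p" n "label (Suc p)"])
    then show "\<exists>q. split_cell p q"
      unfolding split_cell_def adjacent_def by (intro exI[of _ q0] conjI)
  qed
  then obtain q where "\<And>p. split_cell p (q p)"
    by (metis choice)
  then have q_less: "\<And>p i. i < n \<Longrightarrow> q p i < Suc p"
    and q: "\<And>p i. i < n \<Longrightarrow>
      \<exists>u v. adjacent (q p) u \<and> adjacent (q p) v \<and> label (Suc p) u i \<noteq> label (Suc p) v i"
    unfolding split_cell_def by blast+
  have "grid_point n (Suc p) (q p) \<in> unit_cube n" for p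
    using q_less less_imp_le by (intro grid_point_in_cube) blast
  then obtain l r where l: "l \<in> unit_cube n" and r: "strict_mono r"
    and lim: "(\<lambda>k. grid_point n (Suc (r k)) (q (r k))) \<longlonglongrightarrow> l"
    using compact_imp_seq_compact[OF compact_unit_cube, of n]
    unfolding seq_compact_def o_def by meson
  \<comment> \<open>The limit point of the cells picks the set, and thereby the colour, in which late cells lie.\<close>
  obtain \<sigma> j where \<sigma>: "\<sigma> \<subseteq> I" "card \<sigma> = Suc j" "j < n" "l \<in> W \<sigma>"
    using W_cover[OF l] by blast
  have "\<forall>k. \<exists>w. adjacent (q (r k)) (fst w) \<and> adjacent (q (r k)) (snd w)
      \<and> label (Suc (r k)) (fst w) j \<noteq> label (Suc (r k)) (snd w) j"
    using q[OF \<sigma>(3)] by simp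
  from choice[OF this] obtain w where w: "\<And>k. adjacent (q (r k)) (fst (w k)) \<and> adjacent (q (r k)) (snd (w k))
      \<and> label (Suc (r k)) (fst (w k)) j \<noteq> label (Suc (r k)) (snd (w k)) j"
    by blast
  define u v where "u k = fst (w k)" and "v k = snd (w k)" for k
  have uv: "label (Suc (r k)) (u k) j \<noteq> label (Suc (r k)) (v k) j" for k
    using w by (simp add: u_def v_def)
  have u: "\<And>k i. i < n \<Longrightarrow> q (r k) i \<le> u k i \<and> u k i \<le> q (r k) i + 1"
    and v: "\<And>k i. i < n \<Longrightarrow> q (r k) i \<le> v k i \<and> v k i \<le> q (r k) i + 1"
    using w by (auto simp: adjacent_def u_def v_def)
  have ev: "\<forall>\<^sub>F k in sequentially. grid_point n (Suc (r k)) (u k) \<in> W \<sigma> \<and> grid_point n (Suc (r k)) (v k) \<in> W \<sigma>"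
    by (intro eventually_conj topological_tendstoD[OF _ W_open[OF \<sigma>(1)] \<sigma>(4)]
        grid_neighbours_tendsto[OF r lim] u v)
  then obtain k where k: "grid_point n (Suc (r k)) (u k) \<in> W \<sigma>" "grid_point n (Suc (r k)) (v k) \<in> W \<sigma>"
    using eventually_happens'[OF sequentially_bot ev] by blast
  have W_label: "label (Suc (r k)) w j = (if \<exists>y\<in>W \<sigma> \<inter> unit_cube n. y j = 0 then 0 else 1)"
    if w: "grid_point n (Suc (r k)) w \<in> W \<sigma>" "\<forall>i<n. w i \<le> Suc (r k)" for w
  proof -
    have "grid_point n (Suc (r k)) w \<in> unit_cube n"
      using w(2) by (intro grid_point_in_cube) auto
    moreover have "grid_point n (Suc (r k)) w j = 0" if "w j = 0"
      using that by (simp add: grid_point_def)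
    moreover have "near j (grid_point n (Suc (r k)) w) \<longleftrightarrow> (\<exists>y\<in>W \<sigma> \<inter> unit_cube n. y j = 0)"
    proof
      assume "near j (grid_point n (Suc (r k)) w)"
      then obtain \<tau> y where \<tau>: "\<tau> \<subseteq> I" "card \<tau> = Suc j" "grid_point n (Suc (r k)) w \<in> W \<tau>"
        "y \<in> W \<tau> \<inter> unit_cube n" "y j = 0"
        unfolding near_def by blast
      moreover have "\<tau> = \<sigma>"
        using W_eq[OF \<tau>(1) \<sigma>(1) _ \<tau>(3) w(1)] \<tau>(2) \<sigma>(2) by simp
      ultimately show "\<exists>y\<in>W \<sigma> \<inter> unit_cube n. y j = 0"
        by blast
    next
      assume "\<exists>y\<in>W \<sigma> \<inter> unit_cube n. y j = 0"
      then show "near j (grid_point n (Suc (r k)) w)"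
        unfolding near_def using \<sigma>(1,2) w(1) by (intro exI[of _ \<sigma>]) simp
    qed
    ultimately show ?thesis
      using w(1) unfolding label_def by auto
  qed
  have "u k i \<le> Suc (r k)" "v k i \<le> Suc (r k)" if "i < n" for i
    using u[OF that, of k] v[OF that, of k] q_less[OF that, of "r k"] by linarith+
  then show False
    using W_label[OF k(1)] W_label[OF k(2)] uv[of k] by simp
qed


section \<open>Thompson's group acting on the half line\<close>

text \<open>
  The first component is the action of \<open>x\<^sub>k\<close> and its inverse by piecewise linear maps.  The second one
  accumulates the binary logarithm of the right-hand slope: it grows by the logarithm of the
  slope of the letter at the current point, which is the chain rule if words act from
  left to right.
\<close>

fun letter_act :: "nat \<times> bool \<Rightarrow> real \<times> int \<Rightarrow> real \<times> int" where
  "letter_act (k, True) (t, z) =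
    (t + max 0 (min 1 (t - real k)), z + (if real k \<le> t \<and> t < real k + 1 then 1 else 0))"
| "letter_act (k, False) (t, z) =
    (t - max 0 (min 1 ((t - real k) / 2)), z - (if real k \<le> t \<and> t < real k + 2 then 1 else 0))"

lemma letter_act_cancel: "letter_act (k, \<not> e) (letter_act (k, e) q) = q"
  by (cases q; cases e) (auto simp: max_def min_def field_simps)

lemma letter_act_relation:
  assumes "i < j"
  shows "letter_act (i, True) (letter_act (j, True) (letter_act (i, False) q)) = letter_act (Suc j, True) q"
proof -
  obtain t z where q: "q = (t, z)" by (cases q)
  have "real i + 1 \<le> real j" using assms by linarith
  \<comment> \<open>The cases are where the first letter is the identity, has slope 1/2, and is a translation.\<close>
  then consider "t < i" | "i \<le> t" "t < i + 2" | "i + 2 \<le> t"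
    by linarith
  then show ?thesis
  proof cases
    case 1
    then show ?thesis using assms by (auto simp: q max_def min_def)
  next
    case 2
    then have "t < real j + 1" "(t - real i) / 2 < 1" "0 \<le> (t - real i) / 2"
      using \<open>real i + 1 \<le> real j\<close> by auto
    then show ?thesis using 2 \<open>real i + 1 \<le> real j\<close> by (auto simp: q max_def min_def field_simps)
  next
    case 3
    then show ?thesis using \<open>real i + 1 \<le> real j\<close> by (auto simp: q max_def min_def field_simps)
  qed
qed

lemma fold_letter_act_word_eq:
  "word_eq thompson_relations u v \<Longrightarrow> fold letter_act u = fold letter_act v"
proof (induction rule: word_eq.induct)
  case (rel u v)
  then show ?case
    by (auto simp: thompson_relations_def letter_act_relation)
next
  case (cancel a e)
  show ?case by (auto simp: letter_act_cancel)
qed simp_all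

text \<open>
  Words that represent the same group element act alike, so an arbitrary representative will do.
\<close>

definition thompson_act :: "nat word set \<Rightarrow> real \<times> int \<Rightarrow> real \<times> int" where
  "thompson_act g = fold letter_act (SOME u. u \<in> g)"

lemma thompson_act_word_class:
  "thompson_act (word_class thompson_relations u) = fold letter_act u"
proof -
  have "\<exists>v. v \<in> word_class thompson_relations u"
    by (auto simp: word_class_def intro: word_eq.refl)
  then have "word_eq thompson_relations u (SOME v. v \<in> word_class thompson_relations u)"
    unfolding word_class_def mem_Collect_eq by (rule someI_ex)
  then show ?thesis
    by (simp add: thompson_act_def fold_letter_act_word_eq)
qed

interpretation F: group thompson_F by (rule group_thompson_F)

interpretation F: Metric_space "carrier thompson_F" thompson_dist by (rule Metric_space_thompson)

abbreviation F_mult (infixl "\<cdot>" 70) where "F_mult \<equiv> mult thompson_F"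
abbreviation F_pow (infixr "\<up>" 75) where "F_pow g m \<equiv> g [^]\<^bsub>thompson_F\<^esub> (m::nat)"

lemma thompson_act_mult:
  assumes "g \<in> carrier thompson_F" "h \<in> carrier thompson_F"
  shows "thompson_act (g \<cdot> h) q = thompson_act h (thompson_act g q)"
  using assms
  by (auto simp: thompson_F_def presented_group_carrier presented_group_mult thompson_act_word_class)

lemma thompson_act_one: "thompson_act \<one>\<^bsub>thompson_F\<^esub> q = q"
  by (simp add: thompson_F_def presented_group_one thompson_act_word_class)

definition log_slope :: "real \<Rightarrow> nat word set \<Rightarrow> real" where
  "log_slope t g = real_of_int (snd (thompson_act g (t, 0)))"

text \<open>
  The letter acts last, and changes the accumulated logarithm by the logarithm of its own slope at one
  point, which is \<open>-1\<close>, \<open>0\<close> or \<open>1\<close>.  That this holds for multiplication on the right matches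
  the left-invariance of the word metric.
\<close>

lemma log_slope_mult_letter:
  assumes g: "g \<in> carrier thompson_F"
  shows "\<bar>log_slope t (g \<cdot> word_class thompson_relations [(k, e)]) - log_slope t g\<bar> \<le> 1"
proof -
  have step: "\<bar>real_of_int (snd (letter_act (k, e) q)) - real_of_int (snd q)\<bar> \<le> 1" for q
    by (cases q; cases e) auto
  have "word_class thompson_relations [(k, e)] \<in> carrier thompson_F"
    by (simp add: thompson_F_def presented_group_carrier)
  then show ?thesis
    using g step by (simp add: log_slope_def thompson_act_mult thompson_act_word_class)
qed

text \<open>
  A geodesic from \<open>g\<close> to \<open>h\<close> multiplies \<open>g\<close> on the right by one letter after the other.
\<close>

lemma log_slope_Lipschitz:
  assumes g: "g \<in> carrier thompson_F" and h: "h \<in> carrier thompson_F"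
  shows "\<bar>log_slope t g - log_slope t h\<bar> \<le> thompson_dist g h"
proof -
  let ?S = "{thompson_gen 0, thompson_gen 1}"
  have S: "?S \<subseteq> carrier thompson_F"
    by (simp add: thompson_gen_closed)
  obtain ws where ws: "length ws = word_length thompson_F ?S (inv\<^bsub>thompson_F\<^esub> g \<cdot> h)"
    "F.spells ?S ws (inv\<^bsub>thompson_F\<^esub> g \<cdot> h)"
    using F.word_length_witness[OF S thompson_generated, of "inv\<^bsub>thompson_F\<^esub> g \<cdot> h"] g h by auto
  have letter: "\<exists>k e. x = word_class thompson_relations [(k, e)]"
    if "x \<in> ?S \<union> (\<lambda>s. inv\<^bsub>thompson_F\<^esub> s) ` ?S" for x
    using that by (auto simp: inv_thompson_gen) (auto simp: thompson_gen_def)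
  have walk: "\<bar>log_slope t (x \<cdot> foldr (\<cdot>) vs \<one>\<^bsub>thompson_F\<^esub>) - log_slope t x\<bar> \<le> real (length vs)"
    if "set vs \<subseteq> ?S \<union> (\<lambda>s. inv\<^bsub>thompson_F\<^esub> s) ` ?S" "x \<in> carrier thompson_F" for vs x
    using that
  proof (induction vs arbitrary: x)
    case (Cons v vs)
    have v: "v \<in> carrier thompson_F" and vs: "set vs \<subseteq> carrier thompson_F"
      using Cons.prems S by auto
    have "\<bar>log_slope t ((x \<cdot> v) \<cdot> foldr (\<cdot>) vs \<one>\<^bsub>thompson_F\<^esub>) - log_slope t (x \<cdot> v)\<bar> \<le> real (length vs)"
      using Cons v by auto
    moreover have "\<bar>log_slope t (x \<cdot> v) - log_slope t x\<bar> \<le> 1"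
      using letter[of v] Cons.prems log_slope_mult_letter by auto
    ultimately show ?case
      using F.m_assoc[OF Cons.prems(2) v F.foldr_closed[OF vs]] by simp
  qed simp
  have "g \<cdot> (inv\<^bsub>thompson_F\<^esub> g \<cdot> h) = h"
    using g h by (simp flip: F.m_assoc)
  then have "\<bar>log_slope t h - log_slope t g\<bar> \<le> real (length ws)"
    using walk[of ws g] ws(2) g by (simp add: F.spells_def)
  then show ?thesis
    using g h by (simp add: thompson_dist_def word_dist_def ws(1) abs_minus_commute)
qed

section \<open>Commuting elements with prescribed slopes\<close>

text \<open>
  As a map of the half line, \<open>bump i\<close> has support \<open>[2i,2i+2]\<close>, because \<open>x\<^sub>2\<^sub>i\<close> and \<open>x\<^sub>2\<^sub>i\<^sub>+\<^sub>1\<close> agree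
  outside this interval.
\<close>

definition bump :: "nat \<Rightarrow> nat word set" where
  "bump i = thompson_gen (2 * i) \<cdot> inv\<^bsub>thompson_F\<^esub> thompson_gen (2 * i + 1)"

lemma bump_closed [simp]: "bump i \<in> carrier thompson_F"
  by (simp add: bump_def thompson_gen_closed)

lemma bump_act:
  "thompson_act (bump i) (real (2 * j), z) = (real (2 * j), z + (if i = j then 1 else 0))"
proof -
  have b: "bump i = word_class thompson_relations [(2 * i, True), (2 * i + 1, False)]"
    unfolding bump_def inv_thompson_gen
    by (simp add: thompson_gen_def thompson_F_def presented_group_mult)
  consider "i = j" | "i + 1 \<le> j" | "j + 1 \<le> i"
    by linarith
  then show ?thesis
  proof cases
    case 1
    show ?thesis unfolding b using 1 by (auto simp: thompson_act_word_class)
  next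
    case 2
    then have "real i + 1 \<le> real j" by linarith
    then show ?thesis using 2 by (auto simp: b thompson_act_word_class)
  next
    case 3
    then have "real j + 1 \<le> real i" by linarith
    then show ?thesis using 3 by (auto simp: b thompson_act_word_class)
  qed
qed

lemma thompson_gen_commute:
  assumes "i < j"
  shows "thompson_gen j \<cdot> thompson_gen i = thompson_gen i \<cdot> thompson_gen (Suc j)"
  using thompson_relation[OF assms]
  by (metis F.inv_closed F.inv_solve_left F.m_assoc F.m_closed thompson_gen_closed)

text \<open>
  The commutation is derived from the presentation; the action on the half line would only show it
  up to elements that act trivially.  Conjugation by \<open>x\<^sub>2\<^sub>i\<close> and by \<open>x\<^sub>2\<^sub>i\<^sub>+\<^sub>1\<close> both shift the
  index of \<open>x\<^sub>j\<close> by one, and in \<open>bump i\<close> the two shifts cancel.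
\<close>

lemma bump_gen_commute:
  assumes "2 * i + 1 < j"
  shows "bump i \<cdot> thompson_gen j = thompson_gen j \<cdot> bump i"
proof -
  let ?x = thompson_gen and ?i = "\<lambda>k. inv\<^bsub>thompson_F\<^esub> thompson_gen k"
  note c [simp] = thompson_gen_closed
  have "?x (Suc j) \<cdot> ?i (2 * i + 1) = ?i (2 * i + 1) \<cdot> ?x j"
    using thompson_gen_commute[OF assms]
    by (metis F.inv_closed F.inv_solve_left F.inv_solve_right F.m_assoc F.m_closed c)
  then have "bump i \<cdot> ?x j = ?x (2 * i) \<cdot> ?x (Suc j) \<cdot> ?i (2 * i + 1)"
    by (simp add: bump_def F.m_assoc)
  also have "\<dots> = ?x j \<cdot> bump i"
    using thompson_gen_commute[of "2 * i" j] assms by (simp add: bump_def flip: F.m_assoc)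
  finally show ?thesis .
qed

lemma bump_commute: "bump i \<cdot> bump j = bump j \<cdot> bump i"
proof -
  have *: "bump i \<cdot> bump j = bump j \<cdot> bump i" if "i < j" for i j
  proof -
    let ?x = "thompson_gen (2 * j)" and ?y = "thompson_gen (2 * j + 1)"
    have x: "bump i \<cdot> ?x = ?x \<cdot> bump i" and y: "bump i \<cdot> ?y = ?y \<cdot> bump i"
      using that by (auto intro!: bump_gen_commute)
    have "bump i \<cdot> inv\<^bsub>thompson_F\<^esub> ?y = inv\<^bsub>thompson_F\<^esub> ?y \<cdot> bump i"
      using y by (metis F.inv_closed F.inv_solve_left F.inv_solve_right F.m_assoc F.m_closed thompson_gen_closed bump_closed)
    then show ?thesis
      unfolding bump_def[of j] using x
      by (metis F.inv_closed F.m_assoc bump_closed thompson_gen_closed)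
  qed
  show ?thesis
    using *[of i j] *[of j i] by (cases i j rule: linorder_cases) auto
qed

fun bump_product :: "nat \<Rightarrow> (nat \<Rightarrow> nat) \<Rightarrow> nat word set" where
  "bump_product 0 k = \<one>\<^bsub>thompson_F\<^esub>"
| "bump_product (Suc n) k = bump_product n k \<cdot> bump n \<up> k n"

lemma bump_product_closed [simp]: "bump_product n k \<in> carrier thompson_F"
  by (induction n) auto

lemma bump_product_cong: "(\<And>i. i < n \<Longrightarrow> k i = l i) \<Longrightarrow> bump_product n k = bump_product n l"
  by (induction n) auto

lemma bump_product_upd:
  assumes "i < n"
  shows "bump_product n (k(i := k i + m)) = bump_product n k \<cdot> bump i \<up> m"
  using assms
proof (induction n)
  case (Suc n)
  show ?case
  proof (cases "i = n")
    case True
    have "bump_product n (k(n := k n + m)) = bump_product n k"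
      by (intro bump_product_cong) simp
    then show ?thesis
      using True by (simp only: bump_product.simps) (simp add: F.m_assoc F.nat_pow_mult)
  next
    case False
    have "bump i \<up> m \<cdot> bump n \<up> k n = bump n \<up> k n \<cdot> bump i \<up> m"
      by (intro F.group_commutes_pow[OF F.group_commutes_pow[OF bump_commute, symmetric], symmetric]) auto
    then show ?thesis
      using False Suc by (simp add: F.m_assoc)
  qed
qed simp

text \<open>
  Each factor fixes the point \<open>2j\<close>, so the logarithms of the slopes there add up, and only the factor with
  index \<open>j\<close> contributes.
\<close>

lemma log_slope_bump_product:
  assumes "j < n"
  shows "log_slope (real (2 * j)) (bump_product n k) = real (k j)"
proof -
  have pow: "thompson_act (bump i \<up> m) (real (2 * j), z) = (real (2 * j), z + (if i = j then int m else 0))"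
    for i m z
    by (induction m arbitrary: z) (auto simp: thompson_act_one thompson_act_mult bump_act simp del: of_nat_mult)
  have "thompson_act (bump_product n k) (real (2 * j), z)
      = (real (2 * j), z + (if j < n then int (k j) else 0))" for z
    by (induction n) (auto simp: thompson_act_one thompson_act_mult pow simp del: of_nat_mult)
  then show ?thesis
    using assms by (simp add: log_slope_def del: of_nat_mult)
qed

lemma thompson_dist_left_invariant:
  assumes "g \<in> carrier thompson_F" "h \<in> carrier thompson_F"
  shows "thompson_dist g (g \<cdot> h) = thompson_dist \<one>\<^bsub>thompson_F\<^esub> h"
  using assms by (simp add: thompson_dist_def word_dist_def flip: F.m_assoc)

lemma thompson_dist_pow:
  assumes g: "g \<in> carrier thompson_F" and h: "h \<in> carrier thompson_F"
  shows "thompson_dist g (g \<cdot> h \<up> m) \<le> real m * thompson_dist \<one>\<^bsub>thompson_F\<^esub> h"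
proof (induction m)
  case (Suc m)
  have "thompson_dist (g \<cdot> h \<up> m) (g \<cdot> h \<up> Suc m) = thompson_dist \<one>\<^bsub>thompson_F\<^esub> h"
    using g h thompson_dist_left_invariant[of "g \<cdot> h \<up> m" h] by (simp add: F.m_assoc)
  then show ?case
    using Suc F.triangle[of g "g \<cdot> h \<up> m" "g \<cdot> h \<up> Suc m"] g h by (simp add: algebra_simps)
qed (use g in simp)

text \<open>
  The exponents are changed from \<open>k\<close> to \<open>l\<close> one coordinate at a time; since the factors commute, such a
  change is a multiplication on the right by a power of \<open>bump i\<close> or a step in the reverse direction.
\<close>

lemma bump_product_Lipschitz:
  "thompson_dist (bump_product n k) (bump_product n l)
    \<le> (\<Sum>i<n. thompson_dist \<one>\<^bsub>thompson_F\<^esub> (bump i) * \<bar>real (k i) - real (l i)\<bar>)"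
proof -
  let ?c = "\<lambda>i. thompson_dist \<one>\<^bsub>thompson_F\<^esub> (bump i)"
  have up: "thompson_dist (bump_product n k) (bump_product n (k(i := k i + m))) \<le> ?c i * real m"
    if "i < n" for k i m
    using that thompson_dist_pow[of "bump_product n k" "bump i" m] by (simp add: bump_product_upd mult.commute)
  have one: "thompson_dist (bump_product n k) (bump_product n (k(i := v))) \<le> ?c i * \<bar>real (k i) - real v\<bar>"
    if "i < n" for k i v
  proof (cases "k i \<le> v")
    case True
    then show ?thesis
      using up[OF that, of k "v - k i"] by (simp add: of_nat_diff)
  next
    case False
    then show ?thesis
      using up[OF that, of "k(i := v)" "k i - v"] by (simp add: of_nat_diff F.commute)
  qed
  have "thompson_dist (bump_product n k) (bump_product n (\<lambda>i. if i < j then l i else k i))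
      \<le> (\<Sum>i<j. ?c i * \<bar>real (k i) - real (l i)\<bar>)" if "j \<le> n" for j
    using that
  proof (induction j)
    case (Suc j)
    let ?h = "\<lambda>j i. if i < j then l i else k i"
    have "?h (Suc j) = (?h j)(j := l j)"
      by (auto simp: less_Suc_eq)
    then have "thompson_dist (bump_product n (?h j)) (bump_product n (?h (Suc j))) \<le> ?c j * \<bar>real (k j) - real (l j)\<bar>"
      using one[of j "?h j" "l j"] Suc.prems by simp
    then show ?case
      using Suc F.triangle[of "bump_product n k" "bump_product n (?h j)" "bump_product n (?h (Suc j))"]
      by simp
  qed simp
  from this[of n] show ?thesis
    using bump_product_cong[of n "\<lambda>i. if i < n then l i else k i" l] by simp
qed


section \<open>Cubes and covering dimension\<close>

text \<open>
  The sets \<open>U S\<close> below form a finite cover of the space, and over the cube none of them meets two opposite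
  faces.  The dimension hypothesis provides an open refinement with at most \<open>n + 1\<close> sets at each point, possibly
  infinite.  Uniting those members that are assigned to the same \<open>U S\<close> makes it finite without
  raising its multiplicity, and its preimage contradicts the Lebesgue covering theorem in
  dimension \<open>n + 1\<close>.
\<close>

theorem not_covering_dim_le_of_cube_factor:
  assumes \<iota>: "continuous_map euclidean T \<iota>"
    and f: "\<And>j. j \<le> n \<Longrightarrow> continuous_map T euclideanreal (f j)"
    and f_\<iota>: "\<And>x j. x \<in> unit_cube (Suc n) \<Longrightarrow> j \<le> n \<Longrightarrow> f j (\<iota> x) = x j"
  shows "\<not> covering_dim_le T n"
proof
  assume dim: "covering_dim_le T n"
  define U where "U S = {y \<in> topspace T. \<forall>j\<le>n. if j \<in> S then f j y < 2/3 else 1/3 < f j y}" for S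
  have U_open: "openin T (U S)" for S
  proof -
    have "openin T {y \<in> topspace T. f j y \<in> (if j \<in> S then {..<2/3} else {1/3<..})}" if "j \<in> {..n}" for j
      using that by (intro openin_continuous_map_preimage[OF f]) auto
    then have "openin T ((\<Inter>j\<in>{..n}. {y \<in> topspace T. f j y \<in> (if j \<in> S then {..<2/3} else {1/3<..})}) \<inter> topspace T)"
      by (intro openin_INT) auto
    also have "\<dots> = U S"
      by (auto simp: U_def split: if_splits)
    finally show ?thesis .
  qed
  have "\<Union>(U ` Pow {..n}) = topspace T"
  proof
    show "\<Union>(U ` Pow {..n}) \<subseteq> topspace T"
      by (auto simp: U_def)
    show "topspace T \<subseteq> \<Union>(U ` Pow {..n})"
    proof
      fix y assume "y \<in> topspace T"
      then have "y \<in> U {j. j \<le> n \<and> f j y < 2/3}"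
        by (auto simp: U_def)
      moreover have "{j. j \<le> n \<and> f j y < 2/3} \<in> Pow {..n}"
        by auto
      ultimately show "y \<in> \<Union>(U ` Pow {..n})"
        by blast
    qed
  qed
  moreover have "\<forall>V\<in>U ` Pow {..n}. openin T V"
    using U_open by blast
  ultimately have "\<exists>\<V>. (\<forall>V\<in>\<V>. openin T V \<and> (\<exists>W\<in>U ` Pow {..n}. V \<subseteq> W)) \<and> \<Union>\<V> = topspace T \<and>
      (\<forall>y\<in>topspace T. finite {V \<in> \<V>. y \<in> V} \<and> card {V \<in> \<V>. y \<in> V} \<le> n + 1)"
    using dim unfolding covering_dim_le_def by (elim allE[of _ "U ` Pow {..n}"]) simp
  then obtain \<V> where \<V>: "\<forall>V\<in>\<V>. openin T V \<and> (\<exists>W\<in>U ` Pow {..n}. V \<subseteq> W)"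
    and \<V>_cover: "\<Union>\<V> = topspace T"
    and \<V>_order: "\<forall>y\<in>topspace T. finite {V \<in> \<V>. y \<in> V} \<and> card {V \<in> \<V>. y \<in> V} \<le> n + 1"
    by (elim exE conjE)
  have "\<forall>V\<in>\<V>. \<exists>S. S \<subseteq> {..n} \<and> V \<subseteq> U S"
    using \<V> by blast
  from bchoice[OF this] obtain c where c: "\<And>V. V \<in> \<V> \<Longrightarrow> c V \<subseteq> {..n}" "\<And>V. V \<in> \<V> \<Longrightarrow> V \<subseteq> U (c V)"
    by blast
  define A where "A S = \<iota> -` \<Union>{V \<in> \<V>. c V = S}" for S
  have \<iota>_in: "\<iota> x \<in> topspace T" for x
    using \<iota> by (auto simp: continuous_map_def)
  have A_U: "\<iota> x \<in> U S" if "x \<in> A S" for x S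
    using that c(2) unfolding A_def by blast
  obtain S j x y where *: "j < Suc n" "x \<in> A S \<inter> unit_cube (Suc n)" "x j = 0"
    "y \<in> A S \<inter> unit_cube (Suc n)" "y j = 1"
  proof (rule Lebesgue_covering[of "Pow {..n}" A "Suc n"])
    fix S
    have "openin T (\<Union>{V \<in> \<V>. c V = S})"
      using \<V> by (intro openin_Union) simp
    then show "open (A S)"
      using openin_continuous_map_preimage[OF \<iota>, of "\<Union>{V \<in> \<V>. c V = S}"]
      by (simp only: A_def vimage_def open_openin topspace_euclidean UNIV_I simp_thms)
  next
    have "x \<in> (\<Union>S\<in>Pow {..n}. A S)" for x
    proof -
      obtain V where "V \<in> \<V>" "\<iota> x \<in> V"
        using \<iota>_in[of x] unfolding \<V>_cover[symmetric] by blast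
      then have "x \<in> A (c V)" "c V \<in> Pow {..n}"
        using c(1) by (auto simp: A_def)
      then show ?thesis by blast
    qed
    then show "unit_cube (Suc n) \<subseteq> (\<Union>S\<in>Pow {..n}. A S)"
      by blast
  next
    fix x
    have "{S \<in> Pow {..n}. x \<in> A S} \<subseteq> c ` {V \<in> \<V>. \<iota> x \<in> V}"
      by (auto simp: A_def)
    moreover have fin: "finite {V \<in> \<V>. \<iota> x \<in> V}" "card {V \<in> \<V>. \<iota> x \<in> V} \<le> n + 1"
      using \<V>_order \<iota>_in[of x] by blast+
    ultimately have "card {S \<in> Pow {..n}. x \<in> A S} \<le> card {V \<in> \<V>. \<iota> x \<in> V}"
      using surj_card_le by blast
    then show "card {S \<in> Pow {..n}. x \<in> A S} \<le> Suc n"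
      using fin(2) by simp
  qed simp_all
  then have "f j (\<iota> x) = 0" "f j (\<iota> y) = 1"
    by (simp_all add: f_\<iota>)
  moreover have "\<iota> x \<in> U S" "\<iota> y \<in> U S"
    using * A_U by blast+
  ultimately show False
    using * by (auto simp: U_def split: if_splits dest!: spec[of _ j])
qed

section \<open>Cubes in the asymptotic cones\<close>

text \<open>
  An ultrafilter that contains a singleton is principal, so a non-principal one contains the complements
  of all singletons, hence of all finite sets.
\<close>

lemma nonprincipal_ultrafilter_le_sequentially:
  fixes \<omega> :: "nat filter"
  assumes "nonprincipal_ultrafilter \<omega>"
  shows "\<omega> \<le> sequentially"
proof -
  have u: "\<omega> \<noteq> bot" "\<And>P. eventually P \<omega> \<or> eventually (\<lambda>m. \<not> P m) \<omega>" "\<And>m. \<omega> \<noteq> principal {m}"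
    using assms by (auto simp: nonprincipal_ultrafilter_def ultrafilter_def)
  have ne: "\<forall>\<^sub>F m in \<omega>. m \<noteq> N" for N
  proof (rule ccontr)
    assume "\<not> (\<forall>\<^sub>F m in \<omega>. m \<noteq> N)"
    then have N: "\<forall>\<^sub>F m in \<omega>. m = N"
      using u(2)[of "\<lambda>m. m = N"] by blast
    have "eventually P \<omega> \<longleftrightarrow> P N" for P
    proof
      assume "eventually P \<omega>"
      with N have "\<forall>\<^sub>F m in \<omega>. P m \<and> m = N"
        by eventually_elim simp
      then show "P N"
        using eventually_happens'[OF u(1)] by blast
    next
      assume "P N"
      with N show "eventually P \<omega>"
        by (auto elim: eventually_mono)
    qed
    then have "\<omega> = principal {N}"
      by (auto simp: filter_eq_iff eventually_principal)
    then show False using u(3) by blast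
  qed
  have ge: "\<forall>\<^sub>F m in \<omega>. N \<le> m" for N
  proof (induction N)
    case (Suc N)
    with ne[of N] show ?case by eventually_elim auto
  qed simp
  show ?thesis
  proof (rule filter_leI)
    fix P :: "nat \<Rightarrow> bool" assume "eventually P sequentially"
    then obtain N where "\<And>m. N \<le> m \<Longrightarrow> P m"
      by (auto simp: eventually_sequentially)
    with ge[of N] show "eventually P \<omega>"
      by (auto elim: eventually_mono)
  qed
qed

lemma Metric_space_scaled:
  assumes "Metric_space M d" and c: "0 < c"
  shows "Metric_space M (\<lambda>x y. d x y / c)"
proof -
  interpret Metric_space M d by fact
  show ?thesis
  proof
    fix x y z
    show "0 \<le> d x y / c" "d x y / c = d y x / c"
      using c commute by (simp_all add: less_imp_le)
    assume M: "x \<in> M" "y \<in> M"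
    then show "d x y / c = 0 \<longleftrightarrow> x = y"
      using c by simp
    assume "z \<in> M"
    with M show "d x z / c \<le> d x y / c + d y z / c"
      using c triangle[of x y z] by (simp add: divide_right_mono flip: add_divide_distrib)
  qed
qed

locale thompson_cone =
  fixes \<omega> :: "nat filter" and s :: "nat \<Rightarrow> real"
  assumes nonprincipal: "nonprincipal_ultrafilter \<omega>"
    and s_pos: "\<And>m. 0 < s m"
    and s_at_top: "filterlim s at_top sequentially"
begin

sublocale ultralimit \<omega> "carrier thompson_F" "\<lambda>m g h. thompson_dist g h / s m" "\<one>\<^bsub>thompson_F\<^esub>"
  using nonprincipal by (intro ultralimit.intro Metric_space_scaled Metric_space_thompson s_pos)
    (simp_all add: nonprincipal_ultrafilter_def)

abbreviation "cone_class g \<equiv> rel `` {g}"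

sublocale cone: Metric_space "thompson_cone_space \<omega> s" "thompson_cone_dist \<omega> s"
  using ultrafilter s_pos by (rule Metric_space_thompson_cone)

lemma cone_class_in: "g \<in> seqs \<Longrightarrow> cone_class g \<in> thompson_cone_space \<omega> s"
  by (simp add: thompson_cone_space_def ultralimit_space_def quotientI)

lemma cone_dist_tendsto:
  assumes "g \<in> seqs" "h \<in> seqs"
  shows "((\<lambda>m. thompson_dist (g m) (h m) / s m) \<longlongrightarrow> thompson_cone_dist \<omega> s (cone_class g) (cone_class h)) \<omega>"
  unfolding thompson_cone_dist_def ultralimit_dist_class[OF assms] by (rule dist_tendsto[OF assms])

lemma inverse_scale_tendsto: "((\<lambda>m. 1 / s m) \<longlongrightarrow> 0) \<omega>"
proof -
  have "filterlim s at_top \<omega>"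
    using s_at_top nonprincipal_ultrafilter_le_sequentially[OF nonprincipal] by (rule filterlim_mono[OF _ order_refl])
  then show ?thesis
    by (intro tendsto_divide_0[OF tendsto_const] filterlim_at_top_imp_at_infinity)
qed

text \<open>
  Being a Lipschitz function on the group, the logarithmic slope has a rescaled limit that depends only
  on the class of a sequence.
\<close>

definition slope_coordinate :: "nat \<Rightarrow> (nat \<Rightarrow> nat word set) set \<Rightarrow> real" where
  "slope_coordinate j A = Lim \<omega> (\<lambda>m. log_slope (real (2 * j)) ((SOME g. g \<in> A) m) / s m)"

text \<open>
  The limit exists because the identity has slope 1 everywhere, so that the logarithmic slope is bounded
  by the distance from the identity; it is the same for all representatives because
  logarithmic slopes differ by at most the distance.
\<close>

lemma slope_coordinate_tendsto:
  assumes g: "g \<in> seqs"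
  shows "((\<lambda>m. log_slope (real (2 * j)) (g m) / s m) \<longlongrightarrow> slope_coordinate j (cone_class g)) \<omega>"
proof -
  define h where "h = (SOME h. h \<in> cone_class g)"
  have "h \<in> cone_class g"
    unfolding h_def using equiv_class_self[OF equiv_rel g] by (rule someI[of "\<lambda>h. h \<in> cone_class g"])
  then have gh: "(g, h) \<in> rel"
    by simp
  then have h: "h \<in> seqs"
    by (rule relD)
  have h_le: "\<bar>log_slope (real (2 * j)) (h m) / s m\<bar> \<le> \<bar>thompson_dist \<one>\<^bsub>thompson_F\<^esub> (h m) / s m\<bar>" for m
    using log_slope_Lipschitz[of "\<one>\<^bsub>thompson_F\<^esub>" "h m" "real (2 * j)"] seq_in[OF h, of m] s_pos[of m]
    by (simp add: log_slope_def thompson_act_one divide_right_mono)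
  obtain B where "\<And>m. \<bar>thompson_dist \<one>\<^bsub>thompson_F\<^esub> (h m) / s m\<bar> \<le> B"
    using h by (auto simp: ultralimit_seqs_def bounded_iff)
  then have "bounded (range (\<lambda>m. log_slope (real (2 * j)) (h m) / s m))"
    unfolding bounded_iff real_norm_def using h_le by (intro exI[of _ B]) (auto intro: order_trans)
  then obtain l where l: "((\<lambda>m. log_slope (real (2 * j)) (h m) / s m) \<longlongrightarrow> l) \<omega>"
    by (rule ultrafilter_convergent[OF ultrafilter])
  then have "slope_coordinate j (cone_class g) = l"
    unfolding slope_coordinate_def h_def[symmetric] by (rule tendsto_Lim[OF nontrivial])
  moreover have "((\<lambda>m. log_slope (real (2 * j)) (g m) / s m - log_slope (real (2 * j)) (h m) / s m) \<longlongrightarrow> 0) \<omega>"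
  proof (rule Lim_null_comparison[OF always_eventually relD(3)[OF gh]], intro allI)
    fix m
    show "norm (log_slope (real (2 * j)) (g m) / s m - log_slope (real (2 * j)) (h m) / s m)
        \<le> thompson_dist (g m) (h m) / s m"
      using log_slope_Lipschitz[OF seq_in[OF g] seq_in[OF h], of "real (2 * j)" m m] s_pos[of m]
      by (simp add: divide_right_mono flip: diff_divide_distrib)
  qed
  ultimately show ?thesis
    using Lim_transform[OF l, of "\<lambda>m. log_slope (real (2 * j)) (g m) / s m"] by simp
qed

lemma slope_coordinate_Lipschitz:
  assumes "A \<in> thompson_cone_space \<omega> s" "B \<in> thompson_cone_space \<omega> s"
  shows "\<bar>slope_coordinate j A - slope_coordinate j B\<bar> \<le> thompson_cone_dist \<omega> s A B"
proof -
  obtain g h where g: "g \<in> seqs" "A = cone_class g" and h: "h \<in> seqs" "B = cone_class h"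
    using assms by (auto simp: thompson_cone_space_def ultralimit_space_def elim!: quotientE)
  have "\<bar>log_slope (real (2 * j)) (g m) / s m - log_slope (real (2 * j)) (h m) / s m\<bar>
      \<le> thompson_dist (g m) (h m) / s m" for m
    using log_slope_Lipschitz[OF seq_in[OF g(1)] seq_in[OF h(1)], of "real (2 * j)" m m] s_pos[of m]
    by (simp add: divide_right_mono flip: diff_divide_distrib)
  then show ?thesis
    unfolding g(2) h(2)
    by (intro tendsto_le[OF nontrivial cone_dist_tendsto[OF g(1) h(1)]
          tendsto_rabs[OF tendsto_diff[OF slope_coordinate_tendsto[OF g(1)] slope_coordinate_tendsto[OF h(1)]]]])
      simp
qed

lemma continuous_map_slope_coordinate: "continuous_map cone.mtopology euclideanreal (slope_coordinate j)"
  unfolding cone.continuous_map_from_metric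
proof (intro conjI ballI allI impI)
  fix A U assume A: "A \<in> thompson_cone_space \<omega> s" and "openin euclideanreal U \<and> slope_coordinate j A \<in> U"
  then obtain e where e: "0 < e" "\<And>y. dist y (slope_coordinate j A) < e \<Longrightarrow> y \<in> U"
    unfolding open_openin[symmetric] open_dist by blast
  have "slope_coordinate j B \<in> U" if "B \<in> thompson_cone_space \<omega> s" "thompson_cone_dist \<omega> s A B < e" for B
    using slope_coordinate_Lipschitz[OF A that(1), of j] that(2)
    by (intro e(2)) (simp add: dist_real_def abs_minus_commute)
  then show "\<exists>r>0. \<forall>B. B \<in> thompson_cone_space \<omega> s \<and> thompson_cone_dist \<omega> s A B < r \<longrightarrow> slope_coordinate j B \<in> U"
    using e(1) by blast
qed simp

text \<open>
  The real point \<open>x\<close> is approximated by the integer point of the lattice rescaled by \<open>1 / s m\<close>.  All real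
  sequences are admitted, negative coordinates being truncated to 0, so that the map into the cone is
  continuous on the whole space and not just on the cube.
\<close>

definition cube_seq :: "nat \<Rightarrow> (nat \<Rightarrow> real) \<Rightarrow> nat \<Rightarrow> nat word set" where
  "cube_seq n x m = bump_product n (\<lambda>i. nat \<lfloor>x i * s m\<rfloor>)"

text \<open>
  Rounding the exponents down costs at most 1 in each coordinate; this is the term \<open>1 / s m\<close>, which
  vanishes in the limit.
\<close>

lemma cube_seq_dist:
  "thompson_dist (cube_seq n x m) (cube_seq n y m) / s m
    \<le> (\<Sum>i<n. thompson_dist \<one>\<^bsub>thompson_F\<^esub> (bump i) * (\<bar>x i - y i\<bar> + 1 / s m))"
proof -
  have *: "\<bar>real (nat \<lfloor>x i * s m\<rfloor>) - real (nat \<lfloor>y i * s m\<rfloor>)\<bar> \<le> (\<bar>x i - y i\<bar> + 1 / s m) * s m" for i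
  proof -
    have "\<bar>real (nat \<lfloor>a\<rfloor>) - real (nat \<lfloor>b\<rfloor>)\<bar> \<le> \<bar>a - b\<bar> + 1" for a b :: real
      by linarith
    then have "\<bar>real (nat \<lfloor>x i * s m\<rfloor>) - real (nat \<lfloor>y i * s m\<rfloor>)\<bar> \<le> \<bar>x i * s m - y i * s m\<bar> + 1"
      by blast
    also have "\<dots> = (\<bar>x i - y i\<bar> + 1 / s m) * s m"
      using s_pos[of m] by (simp add: distrib_right abs_mult flip: left_diff_distrib)
    finally show ?thesis .
  qed
  have "thompson_dist (cube_seq n x m) (cube_seq n y m)
      \<le> (\<Sum>i<n. thompson_dist \<one>\<^bsub>thompson_F\<^esub> (bump i) * ((\<bar>x i - y i\<bar> + 1 / s m) * s m))"
    unfolding cube_seq_def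
    by (rule order_trans[OF bump_product_Lipschitz]) (intro sum_mono mult_left_mono * F.nonneg)
  also have "\<dots> = (\<Sum>i<n. thompson_dist \<one>\<^bsub>thompson_F\<^esub> (bump i) * (\<bar>x i - y i\<bar> + 1 / s m)) * s m"
    by (simp add: sum_distrib_right mult.assoc)
  finally show ?thesis
    using s_pos[of m] by (simp add: pos_divide_le_eq)
qed

lemma cube_seq_in: "cube_seq n x \<in> seqs"
proof -
  have base: "cube_seq n (\<lambda>_. 0) m = \<one>\<^bsub>thompson_F\<^esub>" for m
    unfolding cube_seq_def by (induction n) auto
  have "\<bar>thompson_dist \<one>\<^bsub>thompson_F\<^esub> (cube_seq n x m) / s m\<bar>
      \<le> (\<Sum>i<n. thompson_dist \<one>\<^bsub>thompson_F\<^esub> (bump i) * \<bar>x i\<bar>)" for m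
  proof -
    have *: "\<bar>real 0 - real (nat \<lfloor>x i * s m\<rfloor>)\<bar> \<le> \<bar>x i\<bar> * s m" for i
    proof -
      have "real (nat \<lfloor>x i * s m\<rfloor>) \<le> \<bar>x i * s m\<bar>"
        by linarith
      then show ?thesis using s_pos[of m] by (simp add: abs_mult)
    qed
    have "thompson_dist (cube_seq n (\<lambda>_. 0) m) (cube_seq n x m)
        \<le> (\<Sum>i<n. thompson_dist \<one>\<^bsub>thompson_F\<^esub> (bump i) * (\<bar>x i\<bar> * s m))"
      unfolding cube_seq_def
      by (rule order_trans[OF bump_product_Lipschitz]) (intro sum_mono mult_left_mono F.nonneg, use * in simp)
    also have "\<dots> = (\<Sum>i<n. thompson_dist \<one>\<^bsub>thompson_F\<^esub> (bump i) * \<bar>x i\<bar>) * s m"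
      by (simp add: sum_distrib_right mult.assoc)
    finally show ?thesis
      using s_pos[of m] by (simp add: base pos_divide_le_eq abs_mult)
  qed
  then show ?thesis
    unfolding ultralimit_seqs_def bounded_iff by (auto simp: cube_seq_def)
qed

lemma cube_class_Lipschitz:
  "thompson_cone_dist \<omega> s (cone_class (cube_seq n x)) (cone_class (cube_seq n y))
    \<le> (\<Sum>i<n. thompson_dist \<one>\<^bsub>thompson_F\<^esub> (bump i) * \<bar>x i - y i\<bar>)"
proof (rule tendsto_le[OF nontrivial _ cone_dist_tendsto[OF cube_seq_in cube_seq_in]])
  have "((\<lambda>m. \<Sum>i<n. thompson_dist \<one>\<^bsub>thompson_F\<^esub> (bump i) * (\<bar>x i - y i\<bar> + 1 / s m))
      \<longlongrightarrow> (\<Sum>i<n. thompson_dist \<one>\<^bsub>thompson_F\<^esub> (bump i) * (\<bar>x i - y i\<bar> + 0))) \<omega>"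
    by (intro tendsto_intros inverse_scale_tendsto)
  then show "((\<lambda>m. \<Sum>i<n. thompson_dist \<one>\<^bsub>thompson_F\<^esub> (bump i) * (\<bar>x i - y i\<bar> + 1 / s m))
      \<longlongrightarrow> (\<Sum>i<n. thompson_dist \<one>\<^bsub>thompson_F\<^esub> (bump i) * \<bar>x i - y i\<bar>)) \<omega>"
    by simp
qed (simp add: cube_seq_dist)

lemma continuous_map_cube_class:
  "continuous_map euclidean cone.mtopology (\<lambda>x. cone_class (cube_seq n x))"
  unfolding cone.continuous_map_to_metric
proof (intro ballI allI impI)
  fix x :: "nat \<Rightarrow> real" and e :: real assume "0 < e"
  let ?U = "{y. (\<Sum>i<n. thompson_dist \<one>\<^bsub>thompson_F\<^esub> (bump i) * \<bar>x i - y i\<bar>) < e}"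
  have "open ?U"
    by (intro open_Collect_less continuous_intros continuous_on_product_coordinates)
  moreover have "x \<in> ?U"
    using \<open>0 < e\<close> by simp
  moreover have "cone_class (cube_seq n y) \<in> cone.mball (cone_class (cube_seq n x)) e" if "y \<in> ?U" for y
    using that cube_class_Lipschitz[of n x y] cone_class_in[OF cube_seq_in] by auto
  ultimately show "\<exists>U. openin euclidean U \<and> x \<in> U \<and>
      (\<forall>y\<in>U. cone_class (cube_seq n y) \<in> cone.mball (cone_class (cube_seq n x)) e)"
    by (intro exI[of _ ?U]) (simp only: open_openin, simp)
qed

lemma slope_coordinate_cube_class:
  assumes "j < n" "0 \<le> x j"
  shows "slope_coordinate j (cone_class (cube_seq n x)) = x j"
proof -
  have "((\<lambda>m. log_slope (real (2 * j)) (cube_seq n x m) / s m) \<longlongrightarrow> x j) \<omega>"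
  proof (rule tendsto_sandwich[OF always_eventually always_eventually])
    show "((\<lambda>m. x j - 1 / s m) \<longlongrightarrow> x j) \<omega>"
      using tendsto_diff[OF tendsto_const inverse_scale_tendsto, of "x j"] by simp
    have floor: "log_slope (real (2 * j)) (cube_seq n x m) = \<lfloor>x j * s m\<rfloor>" for m
      using assms s_pos[of m] log_slope_bump_product[OF assms(1)] by (simp add: cube_seq_def)
    show "\<forall>m. x j - 1 / s m \<le> log_slope (real (2 * j)) (cube_seq n x m) / s m"
    proof
      fix m
      have "x j - 1 / s m = (x j * s m - 1) / s m"
        using s_pos[of m] by (simp add: diff_divide_distrib)
      also have "\<dots> \<le> \<lfloor>x j * s m\<rfloor> / s m"
        using s_pos[of m] by (intro divide_right_mono) linarith+
      finally show "x j - 1 / s m \<le> log_slope (real (2 * j)) (cube_seq n x m) / s m"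
        by (simp only: floor)
    qed
    show "\<forall>m. log_slope (real (2 * j)) (cube_seq n x m) / s m \<le> x j"
      unfolding floor using s_pos by (simp add: pos_divide_le_eq)
  qed simp
  then show ?thesis
    using tendsto_unique[OF nontrivial slope_coordinate_tendsto[OF cube_seq_in]] by blast
qed

lemma not_covering_dim_le_cone: "\<not> covering_dim_le cone.mtopology n"
proof (rule not_covering_dim_le_of_cube_factor)
  show "continuous_map euclidean cone.mtopology (\<lambda>x. cone_class (cube_seq (Suc n) x))"
    by (rule continuous_map_cube_class)
  show "slope_coordinate j (cone_class (cube_seq (Suc n) x)) = x j"
    if "x \<in> unit_cube (Suc n)" "j \<le> n" for x j
    using that by (intro slope_coordinate_cube_class) (auto simp: unit_cube_def)
qed (rule continuous_map_slope_coordinate)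

end

theorem corollary5:
  fixes \<omega> :: "nat filter" and s :: "nat \<Rightarrow> real"
  assumes "nonprincipal_ultrafilter \<omega>"
    and "\<And>m. 0 < s m"
    and "filterlim s at_top sequentially"
  shows "covering_dim (Metric_space.mtopology (thompson_cone_space \<omega> s) (thompson_cone_dist \<omega> s)) = \<infinity>"
proof -
  interpret thompson_cone \<omega> s
    using assms by unfold_locales
  show ?thesis
    by (simp add: covering_dim_def not_covering_dim_le_cone top_enat_def)
qed

end
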